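(* Let $n\ge1$, $-1\le A<B\le1$ and $g(\zeta)=\frac{1+A\zeta}{1+B\zeta}$, $\zeta\in\mathbb D$. Let $f\in\mathcal S_g^*(\mathbb B^n)$. (1) If $z\in\mathbb B^n\setminus\{0\}$ satisfies $\|f(z)\|=\max_{\|\xi\|=\|z\|}\|f(\xi)\|$, then $$|\det J_f(z)|\le\begin{cases}(1+A\|z\|)^{\frac{n(B-A)}{A}}\left(\frac{1+B\|z\|}{1+A\|z\|}\right)^{\frac{n+1}{2}},&A\ne0,\\ e^{n(B-A)\|z\|}\left(\frac{1+B\|z\|}{1+A\|z\|}\right)^{\frac{n+1}{2}},&A=0,\end{cases}$$ and for every $\delta\in T_z^{(1,0)}(\partial\mathbb B^n(0,\|z\|))$ $$\|J_f(z)\delta\|\le\begin{cases}(1+A\|z\|)^{\frac{B-A}{A}}\left(\frac{1+B\|z\|}{1+A\|z\|}\right)^{\frac12}\|\delta\|,&A\ne0,\\ e^{(B-A)\|z\|}\left(\frac{1+B\|z\|}{1+A\|z\|}\right)^{\frac12}\|\delta\|,&A=0.\end{cases}$$ (2) If $z\in\mathbb B^n\setminus\{0\}$ satisfies $\|f(z)\|=\min_{\|\xi\|=\|z\|}\|f(\xi)\|$, then $$|\det J_f(z)|\ge\begin{cases}(1-A\|z\|)^{\frac{n(A-B)}{-A}}\left(\frac{1-A\|z\|}{1-B\|z\|}\right)^{-\frac{n+1}{2}},&A\ne0,\\ e^{n(A-B)\|z\|}\left(\frac{1-A\|z\|}{1-B\|z\|}\right)^{-\frac{n+1}{2}},&A=0,\end{cases}$$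 and for every $\delta\in T_z^{(1,0)}(\partial\mathbb B^n(0,\|z\|))$ $$\|J_f(z)\delta\|\ge\begin{cases}(1-A\|z\|)^{\frac{A-B}{-A}}\left(\frac{1-A\|z\|}{1-B\|z\|}\right)^{-\frac12}\|\delta\|,&A\ne0,\\ e^{(A-B)\|z\|}\left(\frac{1-A\|z\|}{1-B\|z\|}\right)^{-\frac12}\|\delta\|,&A=0.\end{cases}$$
   Context: $\mathbb B^n$ is the open Euclidean unit ball of $\mathbb C^n$ with inner product $\langle z,w\rangle=\sum_j z_j\overline{w_j}$ and norm $\|z\|=\sqrt{\langle z,z\rangle}$; $\mathbb D=\mathbb B^1$; $\partial\mathbb B^n(0,r)=\{z:\|z\|=r\}$. $J_f(z)$ is the complex Jacobian matrix of $f$ at $z$; $I_n$ is the identity matrix. Holomorphic tangent space: for $z\ne0$, $T_z^{(1,0)}(\partial\mathbb B^n(0,\|z\|))=\{w\in\mathbb C^n:\ \sum_j\overline{z_j}w_j=0\}$. $\mathcal S_g^*(\mathbb B^n)$ ($g$-starlike mappings) is the set of holomorphic $f:\mathbb B^n\to\mathbb C^n$ with $f(0)=0$, $J_f(0)=I_n$, $J_f(z)$ nonsingular at every $z\in\mathbb B^n$, such that $$\frac{1}{\|z\|^2}\left\langle [J_f(z)]^{-1}f(z),z\right\rangle\in g(\mathbb D)\quad\text{for all } z\in\mathbb B^n\setminus\{0\}.$$ *)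

theory Defs
  imports "HOL-Complex_Analysis.Complex_Analysis"
begin

text \<open>
  The space \<open>\<complex>\<^sup>n\<close> is the type \<^typ>\<open>complex ^ 'n\<close>. Its library norm is the Euclidean norm
  induced by the Hermitian product below, so \<^term>\<open>ball 0 1\<close> is the unit ball; the library's
  inner product \<open>\<bullet>\<close> is only the real part of the Hermitian one.
\<close>

definition hinner :: "complex ^ 'n \<Rightarrow> complex ^ 'n \<Rightarrow> complex" where
  "hinner z w = (\<Sum>j\<in>UNIV. z $ j * cnj (w $ j))"

text \<open>Complex Frechet differentiability: multiplication by a complex matrix is exactly what a
  complex-linear derivative is.\<close>

definition holomorphic_map_on :: "(complex ^ 'n \<Rightarrow> complex ^ 'm) \<Rightarrow> (complex ^ 'n) set \<Rightarrow> bool" where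
  "holomorphic_map_on f S \<longleftrightarrow>
     (\<forall>z\<in>S. \<exists>M :: complex ^ 'n ^ 'm. (f has_derivative (\<lambda>h. M *v h)) (at z within S))"

text \<open>The entry in row \<open>i\<close>, column \<open>j\<close> is the partial derivative of the \<open>i\<close>-th component
  with respect to the \<open>j\<close>-th complex variable.\<close>

definition cjacobian :: "(complex ^ 'n \<Rightarrow> complex ^ 'm) \<Rightarrow> complex ^ 'n \<Rightarrow> complex ^ 'n ^ 'm" where
  "cjacobian f z = (\<chi> i j. deriv (\<lambda>t. f (z + axis j t) $ i) 0)"

text \<open>For \<open>z \<noteq> 0\<close>, the holomorphic tangent space at \<open>z\<close> of the sphere centred at the origin
  passing through \<open>z\<close>.\<close>

definition hol_tangent_space :: "complex ^ 'n \<Rightarrow> (complex ^ 'n) set" where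
  "hol_tangent_space z = {w. (\<Sum>j\<in>UNIV. cnj (z $ j) * w $ j) = 0}"

definition g_starlike :: "(complex \<Rightarrow> complex) \<Rightarrow> (complex ^ 'n \<Rightarrow> complex ^ 'n) set" where
  "g_starlike g = {f.
     holomorphic_map_on f (ball 0 1) \<and> f 0 = 0 \<and> cjacobian f 0 = mat 1 \<and>
     (\<forall>z\<in>ball 0 1. invertible (cjacobian f z)) \<and>
     (\<forall>z\<in>ball 0 1 - {0}.
        hinner (matrix_inv (cjacobian f z) *v f z) z / of_real ((norm z)\<^sup>2) \<in> g ` ball 0 1)}"

end

theory Submission
  imports Defs "HOL-Real_Asymp.Real_Asymp"
begin

text \<open>
  Let \<open>z\<close> be an extremal point of \<open>\<parallel>f\<parallel>\<close> on its sphere, \<open>r = \<parallel>z\<parallel>\<close>, \<open>J = J\<^sub>f(z)\<close> and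
  \<open>p = \<langle>J\<^sup>-\<^sup>1 f(z), z\<rangle> / r\<^sup>2\<close>. The first-order condition is \<open>J\<^sup>* f(z) = \<lambda> z\<close> with \<open>\<lambda>\<close> real;
  pairing with \<open>J\<^sup>-\<^sup>1 f(z)\<close> gives \<open>\<lambda> = \<parallel>f(z)\<parallel>\<^sup>2 / (r\<^sup>2 p)\<close>, so \<open>p\<close> is real, and the Schwarz lemma
  on the disc through \<open>z\<close> bounds it by the values of \<open>g\<close> at \<open>\<plusminus>r\<close>. The second-order condition along
  complex tangent directions is \<open>\<parallel>J \<delta>\<parallel>\<^sup>2 \<le> \<lambda> \<parallel>\<delta>\<parallel>\<^sup>2\<close> at a maximum and the reverse at a minimum.
  Since \<open>J\<close> maps the tangent space to \<open>f(z)\<^sup>\<bottom>\<close> and \<open>z\<close> to a vector with \<open>f(z)\<close>-component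
  \<open>\<parallel>f(z)\<parallel> / p\<close>, this bounds \<open>|det J|\<close> by \<open>(\<parallel>f(z)\<parallel> / r)\<^sup>n p\<^bsup>-(n+1)/2\<^esup>\<close>. The radial derivative of
  \<open>ln \<parallel>f\<parallel>\<close> at \<open>z\<close> is \<open>1 / (r p)\<close>, which integrates to the growth bound for \<open>\<parallel>f(z)\<parallel> / r\<close>.
  Maxima and minima are treated together through a sign \<open>s = \<plusminus>1\<close>.
\<close>

no_notation fps_nth (infixl "$" 75)

section \<open>Hermitian product and determinants\<close>

lemma hinner_diff_left: "hinner (x - y) w = hinner x w - hinner y w"
  by (simp add: hinner_def algebra_simps sum_subtractf)

lemma hinner_smult_left: "hinner (c *s x) w = c * hinner x w"
  by (simp add: hinner_def sum_distrib_left mult.assoc)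

lemma hinner_commute: "hinner x y = cnj (hinner y x)"
  by (simp add: hinner_def mult.commute)

lemma hinner_diff_right: "hinner w (x - y) = hinner w x - hinner w y"
  by (simp add: hinner_def algebra_simps sum_subtractf)

lemma hinner_smult_right: "hinner x (c *s w) = cnj c * hinner x w"
  by (simp add: hinner_def sum_distrib_left mult_ac)

lemma inner_eq_Re_hinner: "x \<bullet> y = Re (hinner x y)"
  by (simp add: hinner_def inner_vec_def inner_complex_def)

lemma hinner_self: "hinner x x = of_real ((norm x)\<^sup>2)"
proof -
  have "Im (hinner x x) = 0"
    by (simp add: hinner_def)
  then show ?thesis
    by (simp add: complex_eq_iff power2_norm_eq_inner inner_eq_Re_hinner)
qed

lemma norm_smult: "norm (c *s x) = cmod c * norm (x :: complex ^ 'n)"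
  by (simp add: norm_vec_def norm_mult L2_set_right_distrib)

lemma hinner_axis: "hinner x (axis k 1) = x $ k"
  by (simp add: hinner_def axis_def if_distrib[of cnj] if_distrib[of "\<lambda>c. _ * c"] cong: if_cong)

lemma hinner_zero [simp]: "hinner 0 x = 0" "hinner x 0 = 0"
  by (simp_all add: hinner_def)

text \<open>The reflection is \<open>x - 2 \<langle>x, u\<rangle> u / \<parallel>u\<parallel>\<^sup>2\<close> with \<open>u = a - \<parallel>a\<parallel> \<eta> e\<^sub>k\<close>, where the phase
  \<open>\<eta>\<close> makes \<open>\<langle>a, \<eta> e\<^sub>k\<rangle>\<close> real; if \<open>u = 0\<close> the formula degenerates to the identity.\<close>

lemma unitary_involution_to_axis:
  fixes a :: "complex ^ 'n"
  obtains Q :: "complex ^ 'n ^ 'n" and c where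
    "Q ** Q = mat 1" "\<And>x y. hinner (Q *v x) y = hinner x (Q *v y)"
    "Q *v a = c *s axis k 1" "cmod c = norm a"
proof -
  define \<eta> where "\<eta> = (if a $ k = 0 then 1 else sgn (a $ k))"
  have \<eta>: "cmod \<eta> = 1" "a $ k = \<eta> * of_real (cmod (a $ k))"
    by (auto simp: \<eta>_def norm_sgn sgn_div_norm scaleR_conv_of_real norm_mult norm_inverse)
  have \<eta>': "cnj \<eta> * \<eta> = 1"
    using \<eta>(1) by (simp add: complex_norm_square[symmetric] mult.commute)
  define c where "c = of_real (norm a) * \<eta>"
  define u where "u = a - c *s axis k 1"
  define Q :: "complex ^ 'n ^ 'n" where
    "Q = (\<chi> i j. (if i = j then 1 else 0) - 2 * u $ i * cnj (u $ j) / of_real ((norm u)\<^sup>2))"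
  have Q: "Q *v x = x - (2 * hinner x u / of_real ((norm u)\<^sup>2)) *s u" for x
  proof -
    have "(Q *v x) $ i = x $ i - 2 * hinner x u / of_real ((norm u)\<^sup>2) * u $ i" for i
    proof -
      have "(Q *v x) $ i = (\<Sum>j\<in>UNIV. (if i = j then x $ j else 0)
              - 2 * u $ i * (x $ j * cnj (u $ j)) / of_real ((norm u)\<^sup>2))"
        unfolding Q_def matrix_vector_mult_def
        by (auto simp: algebra_simps intro!: sum.cong)
      also have "\<dots> = x $ i - 2 * u $ i * hinner x u / of_real ((norm u)\<^sup>2)"
        by (simp add: sum_subtractf hinner_def flip: sum_distrib_left sum_divide_distrib)
      finally show ?thesis by (simp add: mult_ac)
    qed
    then show ?thesis by (simp add: vec_eq_iff)
  qed
  have 1: "hinner (Q *v x) u = - hinner x u" for x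
    by (cases "u = 0") (auto simp: Q hinner_diff_left hinner_smult_left hinner_self)
  have "Q *v (Q *v x) = x" for x
    by (subst Q) (simp only: 1, simp add: Q vec_eq_iff)
  then have "Q ** Q = mat 1"
    by (simp add: matrix_eq matrix_vector_mul_assoc)
  moreover have "hinner (Q *v x) y = hinner x (Q *v y)" for x y
    using hinner_commute[of y u]
    by (simp add: Q hinner_diff_left hinner_diff_right hinner_smult_left hinner_smult_right)
  moreover have "Q *v a = c *s axis k 1"
  proof (cases "u = 0")
    case True
    then show ?thesis by (simp add: Q u_def)
  next
    case False
    \<comment> \<open>The phase \<open>\<eta>\<close> makes \<open>hinner a (c *s axis k 1)\<close>
      real. This yields \<open>2 * hinner a u = of_real ((norm u)\<^sup>2)\<close>, the condition
      under which the reflection takes \<open>a\<close> to \<open>a - u\<close>.\<close>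
    have ak: "cnj c * a $ k = of_real (norm a * cmod (a $ k))"
      unfolding c_def by (subst \<eta>(2)) (use \<eta>' in \<open>simp add: algebra_simps\<close>)
    then have ak': "c * cnj (a $ k) = of_real (norm a * cmod (a $ k))"
      by (metis complex_cnj_cnj complex_cnj_complex_of_real complex_cnj_mult)
    have cc: "c * cnj c = of_real ((norm a)\<^sup>2)"
      using \<eta>(1) by (simp add: c_def norm_mult power_mult_distrib flip: complex_norm_square del: complex_cnj_mult)
    have "hinner a u = of_real ((norm a)\<^sup>2 - norm a * cmod (a $ k))"
      using ak by (simp add: u_def hinner_diff_right hinner_smult_right hinner_axis hinner_self)
    moreover have "hinner (axis k 1) a = cnj (a $ k)"
      by (metis hinner_axis hinner_commute)
    then have "hinner u u = of_real (2 * ((norm a)\<^sup>2 - norm a * cmod (a $ k)))"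
      using ak ak' cc
      by (simp add: u_def hinner_diff_right hinner_smult_right hinner_axis hinner_self[of a]
          hinner_diff_left hinner_smult_left algebra_simps)
    ultimately have "2 * hinner a u = of_real ((norm u)\<^sup>2)"
      by (simp add: hinner_self)
    then have "Q *v a = a - u"
      using False by (simp add: Q)
    then show ?thesis by (simp add: u_def)
  qed
  moreover have "cmod c = norm a"
    using \<eta>(1) by (simp add: c_def norm_mult)
  ultimately show ?thesis using that by blast
qed

section \<open>Determinant estimates\<close>

lemma norm_det_le:
  fixes M :: "complex ^ 'n ^ 'n"
  assumes "\<And>i j. cmod (M $ i $ j) \<le> K"
  shows "cmod (det M) \<le> fact CARD('n) * K ^ CARD('n)"
proof -
  have "cmod (det M) \<le> (\<Sum>p\<in>{p. p permutes (UNIV :: 'n set)}. K ^ CARD('n))"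
    unfolding det_def
  proof (rule order.trans[OF norm_sum sum_mono])
    fix p :: "'n \<Rightarrow> 'n"
    have "(\<Prod>i\<in>UNIV. cmod (M $ i $ p i)) \<le> (\<Prod>i\<in>(UNIV :: 'n set). K)"
      by (intro prod_mono) (simp add: assms)
    then show "cmod (of_int (sign p) * (\<Prod>i\<in>UNIV. M $ i $ p i)) \<le> K ^ CARD('n)"
      by (simp add: norm_mult sign_def flip: prod_norm)
  qed
  also have "\<dots> = fact CARD('n) * K ^ CARD('n)"
    by (simp add: card_permutations)
  finally show ?thesis .
qed

text \<open>The entries of the \<open>m\<close>-th power are at most
  \<open>1 + real m * \<beta>\<close>, so by \<open>norm_det_le\<close> the \<open>m\<close>-th
  power of \<open>cmod (det M)\<close> grows at most polynomially in \<open>m\<close>. A modulus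
  above 1 would force exponential growth.\<close>

lemma norm_det_le_1_of_linear_growth:
  fixes M :: "complex ^ 'n ^ 'n"
  assumes "\<beta> \<ge> 0" "\<And>m v. norm (((*v) M ^^ m) v) \<le> (1 + real m * \<beta>) * norm v"
  shows "cmod (det M) \<le> 1"
proof (rule ccontr)
  assume d: "\<not> cmod (det M) \<le> 1"
  define P where "P m = (((**) M) ^^ m) (mat 1)" for m
  have P: "P m *v v = ((*v) M ^^ m) v" for m v
    by (induction m) (simp_all add: P_def flip: matrix_vector_mul_assoc)
  have detP: "det (P m) = det M ^ m" for m
    by (induction m) (simp_all add: P_def det_mul)
  have "cmod (P m $ i $ j) \<le> 1 + real m * \<beta>" for m i j
  proof -
    have "P m $ i $ j = (P m *v axis j 1) $ i"
      by (simp add: matrix_vector_mult_def axis_def if_distrib cong: if_cong)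
    also have "cmod \<dots> \<le> norm (P m *v axis j 1)"
      by (rule Finite_Cartesian_Product.norm_nth_le)
    also have "\<dots> \<le> (1 + real m * \<beta>) * norm (axis j 1 :: complex ^ 'n)"
      unfolding P by (rule assms)
    finally show ?thesis by simp
  qed
  then have "cmod (det M) ^ m \<le> fact CARD('n) * (1 + real m * \<beta>) ^ CARD('n)" for m
    using norm_det_le[of "P m" "1 + real m * \<beta>"] by (simp add: detP norm_power)
  moreover have "(\<lambda>m. (1 + real m * \<beta>) ^ CARD('n) / cmod (det M) ^ m) \<longlonglongrightarrow> 0"
  proof -
    \<comment> \<open>Extracting this root writes the quotient as a fixed power of a sum of two null
      sequences.\<close>
    define q where "q = root CARD('n) (cmod (det M))"
    have q: "q > 1" "q ^ CARD('n) = cmod (det M)"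
      using d by (simp_all add: q_def)
    have "(\<lambda>m. (1 / q) ^ m + \<beta> * (real m / q ^ m)) \<longlonglongrightarrow> 0 + \<beta> * 0"
      using q(1) lim_n_over_pown[of q]
      by (intro tendsto_add tendsto_mult tendsto_const LIMSEQ_power_zero) auto
    then have "(\<lambda>m. ((1 / q) ^ m + \<beta> * (real m / q ^ m)) ^ CARD('n)) \<longlonglongrightarrow> 0 ^ CARD('n)"
      by (intro tendsto_power) simp
    also have "(\<lambda>m. ((1 / q) ^ m + \<beta> * (real m / q ^ m)) ^ CARD('n))
        = (\<lambda>m. (1 + real m * \<beta>) ^ CARD('n) / cmod (det M) ^ m)"
      unfolding q(2)[symmetric]
      by (simp add: power_divide add_divide_distrib[symmetric] mult.commute flip: power_mult)
    finally show ?thesis by (simp only: zero_power[OF zero_less_card_finite])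
  qed
  from tendsto_mult[OF tendsto_const this, of "fact CARD('n)"]
  have "eventually (\<lambda>m. fact CARD('n) * ((1 + real m * \<beta>) ^ CARD('n) / cmod (det M) ^ m) < 1)
     sequentially"
    by (intro order_tendstoD) auto
  then obtain m where "fact CARD('n) * ((1 + real m * \<beta>) ^ CARD('n) / cmod (det M) ^ m) < 1"
    by (auto simp: eventually_sequentially)
  moreover have "cmod (det M) ^ m > 0"
    using d by (intro zero_less_power) auto
  ultimately show False
    by (simp add: field_simps not_le) (meson not_le)
qed
text \<open>Replacing row \<open>k\<close> by a unit vector leaves a block triangular matrix whose \<open>m\<close>-th power grows
  only linearly in \<open>m\<close>, so that its determinant cannot exceed 1 in modulus.\<close>

lemma norm_det_le_of_block_triangular:
  fixes M :: "complex ^ 'n ^ 'n"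
  assumes k: "\<And>v. (M *v v) $ k = \<kappa> * v $ k"
    and c: "\<And>v. v $ k = 0 \<Longrightarrow> norm (M *v v) \<le> norm v"
  shows "cmod (det M) \<le> cmod \<kappa>"
proof -
  define N :: "complex ^ 'n ^ 'n" where "N = (\<chi> i. if i = k then axis k 1 else M $ i)"
  have "M $ k = \<kappa> *s axis k 1"
  proof -
    have "M $ k $ j = (M *v axis j 1) $ k" for j
      by (simp add: matrix_vector_mult_def axis_def if_distrib cong: if_cong)
    then show ?thesis
      by (simp add: vec_eq_iff k axis_def)
  qed
  then have "M = (\<chi> i. if i = k then \<kappa> *s axis k 1 else M $ i)"
    by (auto simp: vec_eq_iff)
  then have "det M = det (\<chi> i. if i = k then \<kappa> *s axis k 1 else M $ i)"
    by (rule arg_cong)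
  also have "\<dots> = \<kappa> * det N"
    unfolding N_def by (rule det_row_mul)
  finally have det: "det M = \<kappa> * det N" .
  have Nk: "(N *v v) $ k = v $ k" for v
    by (simp add: N_def matrix_vector_mult_def axis_def if_distrib[of "\<lambda>c. c * _"] cong: if_cong)
  have Ni: "(N *v v) $ i = (M *v v) $ i" if "i \<noteq> k" for v i
    using that by (simp add: N_def matrix_vector_mult_def)
  have eqM: "N *v v = M *v v" if "v $ k = 0" for v
    unfolding vec_eq_iff
  proof
    show "(N *v v) $ i = (M *v v) $ i" for i
      using that Nk[of v] Ni[of i v] k[of v] by (cases "i = k") auto
  qed
  define b where "b = N *v axis k 1 - axis k 1"
  \<comment> \<open>\<open>w v m\<close> has zero \<open>k\<close>-th component, where
    \<open>N\<close> agrees with \<open>M\<close> and does not increase norms. Each further step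
    only adds \<open>v $ k *s b\<close>, so the growth is linear in \<open>m\<close>.\<close>
  define w where "w v m = ((*v) N ^^ m) v - v $ k *s axis k 1" for v m
  have kth: "((*v) N ^^ m) v $ k = v $ k" for v m
    by (induction m) (simp_all add: Nk)
  have w: "norm (w v m) \<le> norm (w v 0) + real m * (cmod (v $ k) * norm b)" for v m
  proof (induction m)
    case (Suc m)
    have "((*v) N ^^ m) v = w v m + v $ k *s axis k 1"
      by (simp add: w_def)
    then have "w v (Suc m) = N *v w v m + v $ k *s b"
      by (simp add: w_def[of v "Suc m"] b_def matrix_vector_right_distrib vector_scalar_commute
          vector_ssub_ldistrib)
    moreover have wk: "w v m $ k = 0"
      by (simp add: w_def kth)
    ultimately have "w v (Suc m) = M *v w v m + v $ k *s b"
      by (simp add: eqM)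
    then have "norm (w v (Suc m)) \<le> norm (M *v w v m) + norm (v $ k *s b)"
      by (simp add: norm_triangle_ineq)
    also have "norm (M *v w v m) \<le> norm (w v m)"
      by (rule c[OF wk])
    finally show ?case
      using Suc by (simp add: norm_smult algebra_simps)
  qed simp
  \<comment> \<open>The 3 pays for three copies of \<open>norm v\<close>: two bound
    \<open>w v 0\<close> and one comes from adding \<open>v $ k *s axis k 1\<close> back. Absorbing
    them into the factor of \<open>real m\<close> uses that \<open>m\<close> is positive;
    \<open>m = 0\<close> is trivial.\<close>
  have "norm (((*v) N ^^ m) v) \<le> (1 + real m * (norm b + 3)) * norm v" for m v
  proof (cases m)
    case (Suc m')
    have vk: "cmod (v $ k) \<le> norm v"
      by (rule Finite_Cartesian_Product.norm_nth_le)
    have "norm (((*v) N ^^ m) v) \<le> norm (w v m) + norm (v $ k *s axis k (1 :: complex) :: complex ^ 'n)"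
      unfolding w_def by norm
    also have "\<dots> \<le> norm (w v 0) + real m * (cmod (v $ k) * norm b) + cmod (v $ k)"
      using w[of v m] by (simp add: norm_smult)
    also have "norm (w v 0) \<le> norm v + norm (v $ k *s axis k (1 :: complex) :: complex ^ 'n)"
      unfolding w_def by (simp add: norm_triangle_ineq4)
    also have "norm v + norm (v $ k *s axis k (1 :: complex) :: complex ^ 'n) +
        real m * (cmod (v $ k) * norm b) + cmod (v $ k)
        \<le> norm v + norm v + real m * (norm v * norm b) + norm v"
      using vk by (intro add_mono mult_left_mono mult_right_mono) (auto simp: norm_smult)
    also have "\<dots> \<le> (1 + real m * (norm b + 3)) * norm v"
      using Suc by (simp add: algebra_simps)
    finally show ?thesis by simp
  qed simp
  then have "cmod (det N) \<le> 1"
    by (rule norm_det_le_1_of_linear_growth[rotated]) simp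
  then show ?thesis
    by (simp add: det norm_mult mult_left_le)
qed

lemma det_smult: "det ((\<chi> i. c *s M $ i) :: complex ^ 'n ^ 'n) = c ^ CARD('n) * det M"
  using det_rows_mul[of "\<lambda>_. c" "\<lambda>i. M $ i"] by simp

text \<open>Unitary involutions carry \<open>a\<close> and \<open>b\<close> to multiples of the same
  axis vector, so that row \<open>k\<close> of the transformed matrix is a multiple of that vector.
  Division by \<open>c\<close> makes it norm-nonincreasing on the hyperplane, and the block
  triangular estimate applies. This serves the Jacobian at a maximum and its inverse at a
  minimum.\<close>

lemma norm_det_le_of_hinner_eq:
  fixes M :: "complex ^ 'n ^ 'n"
  assumes ab: "a \<noteq> 0" "b \<noteq> 0" and c: "c > 0"
    and M: "\<And>v. hinner (M *v v) b = of_real l * hinner v a"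
    and tangent: "\<And>v. hinner v a = 0 \<Longrightarrow> norm (M *v v) \<le> c * norm v"
  shows "cmod (det M) \<le> c ^ (CARD('n) - 1) * (\<bar>l\<bar> * norm a / norm b)"
proof -
  obtain k :: 'n where True by blast
  obtain Qa :: "complex ^ 'n ^ 'n" and ca where Qa:
    "Qa ** Qa = mat 1" "\<And>x y. hinner (Qa *v x) y = hinner x (Qa *v y)"
    "Qa *v a = ca *s axis k 1" "cmod ca = norm a"
    by (rule unitary_involution_to_axis[of a k]) (rule that)
  obtain Qb :: "complex ^ 'n ^ 'n" and cb where Qb:
    "Qb ** Qb = mat 1" "\<And>x y. hinner (Qb *v x) y = hinner x (Qb *v y)"
    "Qb *v b = cb *s axis k 1" "cmod cb = norm b"
    by (rule unitary_involution_to_axis[of b k]) (rule that)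
  have isometry: "norm (Q *v x) = norm x"
    if "Q ** Q = mat 1" "\<And>x y. hinner (Q *v x) y = hinner x (Q *v y)" for Q :: "complex ^ 'n ^ 'n" and x
  proof -
    have "hinner (Q *v x) (Q *v x) = hinner x x"
      using that by (simp add: matrix_vector_mul_assoc)
    then show ?thesis
      by (simp add: hinner_self flip: of_real_power)
  qed
  have unimodular: "cmod (det Q) = 1" if "Q ** Q = mat 1" for Q :: "complex ^ 'n ^ 'n"
  proof -
    have "det Q * det Q = 1"
      using that by (metis det_I det_mul)
    then have "cmod (det Q) ^ 2 = 1"
      by (metis norm_mult norm_one power2_eq_square)
    then show ?thesis by (smt (verit) norm_ge_zero power2_eq_1_iff)
  qed
  define N where "N = Qb ** M ** Qa"
  define N' :: "complex ^ 'n ^ 'n" where "N' = (\<chi> i. of_real (1 / c) *s N $ i)"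
  have Nv: "N *v v = Qb *v (M *v (Qa *v v))" for v
    by (simp add: N_def matrix_vector_mul_assoc matrix_mul_assoc)
  have N': "N' *v v = of_real (1 / c) *s (N *v v)" for v
    by (simp add: N'_def matrix_vector_mult_def vec_eq_iff sum_distrib_left)
  have key: "cnj cb * (N *v v) $ k = of_real l * (cnj ca * v $ k)" for v
  proof -
    have "cnj cb * (N *v v) $ k = hinner (N *v v) (Qb *v b)"
      by (simp add: Qb(3) hinner_smult_right hinner_axis)
    also have "\<dots> = hinner (Qb *v (N *v v)) b"
      by (simp only: Qb(2))
    also have "\<dots> = of_real l * hinner (Qa *v v) a"
      by (simp add: Nv matrix_vector_mul_assoc Qb(1) matrix_mul_assoc)
         (simp add: M flip: matrix_vector_mul_assoc)
    also have "hinner (Qa *v v) a = cnj ca * v $ k"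
      by (simp add: Qa(2,3) hinner_smult_right hinner_axis)
    finally show ?thesis .
  qed
  have nz: "ca \<noteq> 0" "cb \<noteq> 0"
    using ab Qa(4) Qb(4) by auto
  define \<kappa> where "\<kappa> = of_real (1 / c) * (of_real l * cnj ca / cnj cb)"
  have "cmod (det N') \<le> cmod \<kappa>"
  proof (rule norm_det_le_of_block_triangular)
    show "(N' *v v) $ k = \<kappa> * v $ k" for v
      using key[of v] nz c by (simp add: N' \<kappa>_def field_simps)
  next
    fix v :: "complex ^ 'n" assume v: "v $ k = 0"
    have "hinner (Qa *v v) a = 0"
      using v by (simp add: Qa(2,3) hinner_smult_right hinner_axis)
    then have "norm (M *v (Qa *v v)) \<le> c * norm (Qa *v v)"
      by (rule tangent)
    then show "norm (N' *v v) \<le> norm v"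
      using c by (simp add: N' norm_smult Nv isometry[OF Qa(1,2)] isometry[OF Qb(1,2)] norm_divide field_simps)
  qed
  moreover have "cmod (det N') = cmod (det M) / c ^ CARD('n)"
    using c by (simp add: N'_def det_smult N_def det_mul norm_mult unimodular Qa(1) Qb(1) norm_power
        norm_divide power_divide)
  moreover have "cmod \<kappa> = (\<bar>l\<bar> * norm a / norm b) / c"
    using c by (simp add: \<kappa>_def norm_mult norm_divide Qa(4) Qb(4))
  moreover have "c ^ CARD('n) = c * c ^ (CARD('n) - 1)"
    by (metis power_minus_mult zero_less_card_finite mult.commute)
  ultimately show ?thesis
    using c by (simp add: field_simps)
qed

section \<open>Holomorphic maps along complex lines\<close>

lemma has_derivative_line_component:
  fixes f :: "complex ^ 'n \<Rightarrow> complex ^ 'm"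
  assumes "(f has_derivative (*v) M) (at (a + \<zeta> *s b))"
  shows "((\<lambda>t. f (a + t *s b) $ i) has_field_derivative (M *v b) $ i) (at \<zeta>)"
proof -
  have "linear (\<lambda>t. t *s b)"
    by (rule linearI) (auto simp: vec_eq_iff algebra_simps)
  then have "bounded_linear (\<lambda>t. t *s b)"
    by (simp add: linear_conv_bounded_linear)
  then have "((\<lambda>t. a + t *s b) has_derivative (\<lambda>t. t *s b)) (at \<zeta>)"
    using has_derivative_add[OF has_derivative_const bounded_linear_imp_has_derivative] by fastforce
  from diff_chain_at[OF this assms]
  have "((\<lambda>t. f (a + t *s b)) has_derivative (\<lambda>t. M *v (t *s b))) (at \<zeta>)"
    by (simp add: o_def)
  then have "((\<lambda>t. f (a + t *s b) $ i) has_derivative (\<lambda>t. (M *v (t *s b)) $ i)) (at \<zeta>)"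
    by (rule bounded_linear.has_derivative[OF bounded_linear_vec_nth])
  moreover have "(\<lambda>t. (M *v (t *s b)) $ i) = (*) ((M *v b) $ i)"
    by (auto simp: vector_scalar_commute mult.commute)
  ultimately show ?thesis
    by (simp add: has_field_derivative_def)
qed

text \<open>Column \<open>j\<close> of a complex derivative matrix is the derivative along
  \<open>axis j 1\<close>, which is how \<open>cjacobian\<close> is defined. Hence the matrix
  provided by \<open>holomorphic_map_on\<close> can only be \<open>cjacobian f z\<close>.\<close>

lemma has_derivative_cjacobian:
  fixes f :: "complex ^ 'n \<Rightarrow> complex ^ 'm"
  assumes "holomorphic_map_on f S" "open S" "z \<in> S"
  shows "(f has_derivative (*v) (cjacobian f z)) (at z)"
proof -
  obtain M where "(f has_derivative (*v) M) (at z within S)"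
    using assms unfolding holomorphic_map_on_def by metis
  then have M: "(f has_derivative (*v) M) (at z)"
    using at_within_open[OF assms(3,2)] by simp
  have "cjacobian f z $ i $ j = M $ i $ j" for i j
  proof -
    have "((\<lambda>t. f (z + t *s axis j 1) $ i) has_field_derivative (M *v axis j 1) $ i) (at 0)"
      by (rule has_derivative_line_component) (use M in simp)
    moreover have "t *s axis j 1 = (axis j t :: complex ^ 'n)" for t
      by (auto simp: vec_eq_iff axis_def)
    moreover have "(M *v axis j 1) $ i = M $ i $ j"
      by (simp add: matrix_vector_mult_def axis_def if_distrib cong: if_cong)
    ultimately show ?thesis
      by (simp add: cjacobian_def DERIV_imp_deriv)
  qed
  then have "cjacobian f z = M"
    by (simp add: vec_eq_iff)
  then show ?thesis
    using M by simp
qed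

section \<open>Taylor estimates and four-point means in one variable\<close>

lemma holomorphic_Taylor_bound:
  assumes F: "F holomorphic_on ball 0 \<rho>" and "\<rho> > 0"
    and M: "\<And>w. cmod w < \<rho> \<Longrightarrow> cmod (F w) \<le> M"
    and w: "cmod w \<le> \<rho> / 2"
  shows "cmod (F w - (\<Sum>i\<le>n. (deriv ^^ i) F 0 * w ^ i / fact i)) \<le> (real n + 1) * M * (4 * cmod w / \<rho>) ^ Suc n"
proof -
  have "cmod ((deriv ^^ 0) F w - (\<Sum>i\<le>n. (deriv ^^ i) F 0 * (w - 0) ^ i / fact i))
      \<le> (fact (Suc n) * M / (\<rho> / 4) ^ Suc n) * cmod (w - 0) ^ Suc n / fact n"
  proof (rule complex_Taylor)
    show "convex (cball (0 :: complex) (\<rho> / 2))" by simp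
    show "((deriv ^^ i) F has_field_derivative (deriv ^^ Suc i) F x) (at x within cball 0 (\<rho> / 2))"
      if "x \<in> cball 0 (\<rho> / 2)" for i x
    proof (rule has_field_derivative_at_within)
      show "((deriv ^^ i) F has_field_derivative (deriv ^^ Suc i) F x) (at x)"
        using that \<open>\<rho> > 0\<close> by (intro has_field_derivative_higher_deriv[OF F]) auto
    qed
    \<comment> \<open>Circles of radius \<open>\<rho> / 4\<close> about points of the half disc stay
      where \<open>M\<close> bounds \<open>F\<close>; this is the source of the factor 4 in the
      conclusion.\<close>
    show "cmod ((deriv ^^ Suc n) F x) \<le> fact (Suc n) * M / (\<rho> / 4) ^ Suc n"
      if x: "x \<in> cball 0 (\<rho> / 2)" for x
    proof (rule Cauchy_inequality)
      have "norm y < \<rho>" if "dist x y \<le> \<rho> / 4" for y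
        using x that \<open>\<rho> > 0\<close> norm_triangle_ineq2[of y x] by (auto simp: dist_norm norm_minus_commute)
      then have sub: "cball x (\<rho> / 4) \<subseteq> ball 0 \<rho>"
        by (auto simp: dist_norm)
      then show "F holomorphic_on ball x (\<rho> / 4)"
        using F by (rule_tac holomorphic_on_subset) auto
      show "continuous_on (cball x (\<rho> / 4)) F"
        using F sub by (meson holomorphic_on_imp_continuous_on continuous_on_subset)
      show "\<rho> / 4 > 0" using \<open>\<rho> > 0\<close> by simp
      show "cmod (F y) \<le> M" if "cmod (x - y) = \<rho> / 4" for y
        using that sub by (intro M) (auto simp: dist_norm subset_iff)
    qed
  qed (use w \<open>\<rho> > 0\<close> in auto)
  also have "\<dots> = (real n + 1) * M * (4 * cmod w / \<rho>) ^ Suc n"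
    using \<open>\<rho> > 0\<close> by (simp add: field_simps power_mult_distrib power_divide)
  finally show ?thesis by simp
qed

text \<open>A discrete Parseval identity: the mixed terms carry \<open>\<i> ^ k\<close>, its
  conjugate or \<open>(- 1) ^ k\<close>, each of which sums to zero over
  \<open>k < 4\<close>.\<close>

lemma sum_power2_roots_of_unity_4:
  fixes a b c :: complex and \<epsilon> :: real
  shows "(\<Sum>k<4. (cmod (a + b * (\<epsilon> * \<i> ^ k) + c * (\<epsilon> * \<i> ^ k)\<^sup>2))\<^sup>2)
     = 4 * ((cmod a)\<^sup>2 + \<epsilon>\<^sup>2 * (cmod b)\<^sup>2 + \<epsilon> ^ 4 * (cmod c)\<^sup>2)"
proof -
  have "{..<4} = {0, 1, 2, 3 :: nat}" by auto
  moreover have "\<i> ^ 3 = - \<i>" by (simp add: power3_eq_cube)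
  ultimately show ?thesis
    by (simp add: cmod_power2 power_mult_distrib) (simp add: algebra_simps power2_eq_square power4_eq_xxxx)
qed

text \<open>Replacing \<open>F\<close> by its quadratic Taylor polynomial costs order
  \<open>\<epsilon> ^ 3\<close>. For the polynomial the mean is known exactly, and its second
  coefficient enters only with \<open>\<epsilon> ^ 4\<close>.\<close>

lemma four_point_mean_expansion:
  assumes F: "F holomorphic_on ball 0 \<rho>" and "\<rho> > 0"
    and M: "\<And>w. cmod w < \<rho> \<Longrightarrow> cmod (F w) \<le> M"
    and \<epsilon>: "0 < \<epsilon>" "\<epsilon> \<le> \<rho> / 4"
  shows "\<bar>(\<Sum>k<4. (cmod (F (\<epsilon> * \<i> ^ k)))\<^sup>2) / 4 - (cmod (F 0))\<^sup>2 - \<epsilon>\<^sup>2 * (cmod (deriv F 0))\<^sup>2\<bar>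
      \<le> 1000 * M\<^sup>2 / \<rho> ^ 3 * \<epsilon> ^ 3"
proof -
  define a2 where "a2 = (deriv ^^ 2) F 0 / 2"
  define P where "P w = F 0 + deriv F 0 * w + a2 * w\<^sup>2" for w
  have M0: "M \<ge> 0"
    using M[of 0] \<open>\<rho> > 0\<close> norm_ge_zero[of "F 0"] by (simp del: norm_ge_zero)
  have "cmod (a2) \<le> 4 * M / \<rho>\<^sup>2"
  proof -
    have sub: "cball 0 (\<rho> / 2) \<subseteq> ball (0 :: complex) \<rho>"
      using \<open>\<rho> > 0\<close> by auto
    have "cmod ((deriv ^^ 2) F 0) \<le> fact 2 * M / (\<rho> / 2)\<^sup>2"
    proof (rule Cauchy_inequality)
      show "F holomorphic_on ball 0 (\<rho> / 2)"
        using F sub by (rule_tac holomorphic_on_subset) auto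
      show "continuous_on (cball 0 (\<rho> / 2)) F"
        using F sub by (meson holomorphic_on_imp_continuous_on continuous_on_subset)
      show "cmod (F y) \<le> M" if "cmod (0 - y) = \<rho> / 2" for y
        using that \<open>\<rho> > 0\<close> by (intro M) auto
    qed (use \<open>\<rho> > 0\<close> in auto)
    then show ?thesis
      by (simp add: a2_def norm_divide power_divide)
  qed
  then have "(cmod a2)\<^sup>2 \<le> (4 * M / \<rho>\<^sup>2)\<^sup>2"
    by (intro power_mono) auto
  moreover have "\<epsilon> ^ 4 \<le> \<rho> / 4 * \<epsilon> ^ 3"
    using \<epsilon> by (simp add: power4_eq_xxxx power3_eq_cube mult_right_mono)
  ultimately have "\<epsilon> ^ 4 * (cmod a2)\<^sup>2 \<le> (\<rho> / 4 * \<epsilon> ^ 3) * (4 * M / \<rho>\<^sup>2)\<^sup>2"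
    using \<epsilon> \<open>\<rho> > 0\<close> by (intro mult_mono) auto
  also have "\<dots> = 4 * M\<^sup>2 / \<rho> ^ 3 * \<epsilon> ^ 3"
    using \<open>\<rho> > 0\<close> by (simp add: field_simps power2_eq_square power3_eq_cube)
  finally have quartic: "\<epsilon> ^ 4 * (cmod a2)\<^sup>2 \<le> 4 * M\<^sup>2 / \<rho> ^ 3 * \<epsilon> ^ 3" .
  \<comment> \<open>Since \<open>4 * \<epsilon> / \<rho>\<close> is at most 1, the Taylor error is
    at most \<open>3 * M\<close> and \<open>P\<close> is at most \<open>4 * M\<close>. The constant
    is 3 times \<open>4 ^ 3\<close> times \<open>1 + 4\<close>; adding the 4 of
    \<open>quartic\<close> keeps it below 1000.\<close>
  have err: "\<bar>(cmod (F w))\<^sup>2 - (cmod (P w))\<^sup>2\<bar> \<le> 960 * M\<^sup>2 / \<rho> ^ 3 * \<epsilon> ^ 3" if w: "cmod w = \<epsilon>" for w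
  proof -
    define R where "R = cmod (F w - P w)"
    have "{..2} = {0, 1, 2 :: nat}" by auto
    then have R: "R \<le> 3 * M * (4 * \<epsilon> / \<rho>) ^ 3"
      using holomorphic_Taylor_bound[OF F \<open>\<rho> > 0\<close> M, of w 2] w \<epsilon> \<open>\<rho> > 0\<close>
      by (simp add: R_def P_def a2_def numeral_2_eq_2 numeral_3_eq_3 algebra_simps)
    also have "\<dots> \<le> 3 * M * 1"
      using \<epsilon> \<open>\<rho> > 0\<close> M0 by (intro mult_left_mono power_le_one) auto
    finally have R': "R \<le> 3 * M" by simp
    have Fw: "cmod (F w) \<le> M"
      using w \<epsilon> \<open>\<rho> > 0\<close> by (intro M) auto
    have Pw: "cmod (P w) \<le> 4 * M"
      using R' Fw norm_triangle_ineq2[of "P w" "F w"] by (simp add: R_def norm_minus_commute)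
    have "\<bar>(cmod (F w))\<^sup>2 - (cmod (P w))\<^sup>2\<bar> = \<bar>cmod (F w) - cmod (P w)\<bar> * (cmod (F w) + cmod (P w))"
      by (simp add: power2_eq_square square_diff_square_factored abs_mult)
    also have "\<dots> \<le> (3 * M * (4 * \<epsilon> / \<rho>) ^ 3) * (M + 4 * M)"
    proof (intro mult_mono)
      show "\<bar>cmod (F w) - cmod (P w)\<bar> \<le> 3 * M * (4 * \<epsilon> / \<rho>) ^ 3"
        using R norm_triangle_ineq3[of "F w" "P w"] by (simp add: R_def)
    qed (use M0 \<epsilon> \<open>\<rho> > 0\<close> Fw Pw in auto)
    also have "\<dots> = 960 * M\<^sup>2 / \<rho> ^ 3 * \<epsilon> ^ 3"
      using \<open>\<rho> > 0\<close> by (simp add: field_simps power2_eq_square power3_eq_cube)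
    finally show ?thesis .
  qed
  define E where "E = 960 * M\<^sup>2 / \<rho> ^ 3 * \<epsilon> ^ 3"
  have "\<bar>(\<Sum>k<4. (cmod (F (\<epsilon> * \<i> ^ k)))\<^sup>2 - (cmod (P (\<epsilon> * \<i> ^ k)))\<^sup>2)\<bar> \<le> (\<Sum>k<(4::nat). E)"
    unfolding E_def by (intro order.trans[OF sum_abs sum_mono] err) (use \<epsilon> in \<open>simp add: norm_mult norm_power\<close>)
  then have "\<bar>(\<Sum>k<4. (cmod (F (\<epsilon> * \<i> ^ k)))\<^sup>2)
      - 4 * ((cmod (F 0))\<^sup>2 + \<epsilon>\<^sup>2 * (cmod (deriv F 0))\<^sup>2 + \<epsilon> ^ 4 * (cmod a2)\<^sup>2)\<bar> \<le> 4 * E"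
    by (simp add: sum_subtractf P_def sum_power2_roots_of_unity_4)
  moreover have arith: "\<bar>S / 4 - x - y\<bar> \<le> Y"
    if "\<bar>S - 4 * (x + y + q)\<bar> \<le> 4 * E" "0 \<le> q" "E + X \<le> Y" "0 \<le> X" "q \<le> X" for S x y q E X Y :: real
    using that unfolding abs_le_iff by (simp add: field_simps)
  moreover have "0 \<le> \<epsilon> ^ 4 * (cmod a2)\<^sup>2" by simp
  moreover have "E + 4 * M\<^sup>2 / \<rho> ^ 3 * \<epsilon> ^ 3 \<le> 1000 * M\<^sup>2 / \<rho> ^ 3 * \<epsilon> ^ 3"
    using \<epsilon> \<open>\<rho> > 0\<close> by (simp add: E_def flip: distrib_right add_divide_distrib)
      (intro mult_right_mono divide_right_mono, auto)
  moreover have "0 \<le> 4 * M\<^sup>2 / \<rho> ^ 3 * \<epsilon> ^ 3"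
    using \<epsilon> \<open>\<rho> > 0\<close> by simp
  ultimately show ?thesis
    using quartic by (intro arith)
qed

text \<open>\<open>holomorphic_map_on\<close> gives only pointwise derivatives, so regularity of the
  Jacobian has to be derived. On a smaller disc an entry is the uniform limit of difference
  quotients along \<open>axis j 1\<close>. These are holomorphic in \<open>\<zeta>\<close>, and the
  Taylor bound makes their error uniform.\<close>

lemma holomorphic_cjacobian_line:
  fixes f :: "complex ^ 'n \<Rightarrow> complex ^ 'm"
  assumes f: "holomorphic_map_on f (ball 0 1)" and u: "norm u = 1"
  shows "(\<lambda>\<zeta>. cjacobian f (\<zeta> *s u) $ i $ j) holomorphic_on ball 0 1"
proof -
  have *: "(\<lambda>\<zeta>. cjacobian f (\<zeta> *s u) $ i $ j) holomorphic_on ball 0 \<rho>" if \<rho>: "0 < \<rho>" "\<rho> < 1" for \<rho>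
  proof -
    define \<tau> where "\<tau> = (1 - \<rho>) / 2"
    have \<tau>: "\<tau> > 0" "\<rho> + \<tau> < 1" using \<rho> by (auto simp: \<tau>_def field_simps)
    have df: "(f has_derivative (*v) (cjacobian f x)) (at x)" if "norm x < 1" for x
      using that by (intro has_derivative_cjacobian[OF f]) auto
    have contf: "continuous_on (cball 0 (\<rho> + \<tau>)) f"
      using \<tau> by (intro continuous_at_imp_continuous_on ballI has_derivative_continuous[OF df]) auto
    then have "compact (f ` cball 0 (\<rho> + \<tau>))"
      by (intro compact_continuous_image) auto
    then obtain M where "\<And>y. y \<in> f ` cball 0 (\<rho> + \<tau>) \<Longrightarrow> norm y \<le> M"
      using compact_imp_bounded bounded_iff by metis
    then have M: "\<And>x. norm x \<le> \<rho> + \<tau> \<Longrightarrow> norm (f x) \<le> M"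
      by simp
    have M0: "M \<ge> 0"
      using M[of 0] \<rho> \<tau> norm_ge_zero[of "f 0"] by (auto simp del: norm_ge_zero)
    define F where "F \<zeta> t = f (\<zeta> *s u + t *s axis j 1) $ i" for \<zeta> t
    have in_ball: "norm (\<zeta> *s u + t *s axis j 1) \<le> \<rho> + \<tau>" if "cmod \<zeta> \<le> \<rho>" "cmod t \<le> \<tau>" for \<zeta> t
      using that by (intro norm_triangle_le) (simp add: norm_smult u)
    \<comment> \<open>The shift by 2 keeps even \<open>h 0\<close> within \<open>\<tau> / 2\<close>,
      the range of the Taylor bound.\<close>
    define h where "h n = \<tau> / (real n + 2)" for n
    have h: "0 < h n" "h n \<le> \<tau> / 2" for n
      using \<tau> by (auto simp: h_def field_simps)
    have dF: "cjacobian f (\<zeta> *s u) $ i $ j = deriv (F \<zeta>) 0" for \<zeta>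
    proof -
      have "t *s axis j 1 = (axis j t :: complex ^ 'n)" for t
        by (auto simp: vec_eq_iff axis_def)
      then show ?thesis by (simp add: cjacobian_def F_def[abs_def])
    qed
    define q where "q n \<zeta> = (F \<zeta> (h n) - F \<zeta> 0) / h n" for n \<zeta>
    have err: "cmod (q n \<zeta> - deriv (F \<zeta>) 0) \<le> 32 * M / \<tau>\<^sup>2 * h n" if \<zeta>: "cmod \<zeta> \<le> \<rho>" for n \<zeta>
    proof -
      have "F \<zeta> holomorphic_on ball 0 \<tau>"
        unfolding holomorphic_on_open[OF open_ball]
      proof
        fix t :: complex assume "t \<in> ball 0 \<tau>"
        then have "norm (\<zeta> *s u + t *s axis j 1) < 1"
          using in_ball[of \<zeta> t] \<zeta> \<tau> by auto
        from has_derivative_line_component[OF df[OF this]]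
        show "\<exists>D. (F \<zeta> has_field_derivative D) (at t)"
          unfolding F_def by blast
      qed
      moreover have "cmod (F \<zeta> t) \<le> M" if "cmod t < \<tau>" for t
        unfolding F_def using M[OF in_ball[of \<zeta> t]] \<zeta> that
        by (auto intro: order.trans[OF Finite_Cartesian_Product.norm_nth_le])
      ultimately have "cmod (F \<zeta> (h n) - (\<Sum>k\<le>1. (deriv ^^ k) (F \<zeta>) 0 * of_real (h n) ^ k / fact k))
          \<le> (real 1 + 1) * M * (4 * cmod (h n) / \<tau>) ^ Suc 1"
        using \<tau> h[of n] by (intro holomorphic_Taylor_bound) auto
      then have 1: "cmod (F \<zeta> (h n) - F \<zeta> 0 - deriv (F \<zeta>) 0 * h n) \<le> 2 * M * (4 * h n / \<tau>)\<^sup>2"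
        using h[of n] by (simp add: algebra_simps numeral_2_eq_2)
      have "cmod (q n \<zeta> - deriv (F \<zeta>) 0) = cmod ((F \<zeta> (h n) - F \<zeta> 0 - deriv (F \<zeta>) 0 * h n) / h n)"
        using h[of n] by (simp add: q_def field_simps)
      also have "\<dots> \<le> 2 * M * (4 * h n / \<tau>)\<^sup>2 / h n"
        using 1 h[of n] by (simp add: norm_divide divide_right_mono)
      also have "\<dots> = 32 * M / \<tau>\<^sup>2 * h n"
        using h[of n] \<tau> by (simp add: field_simps power2_eq_square)
      finally show ?thesis .
    qed
    have lim: "uniform_limit (ball 0 \<rho>) q (\<lambda>\<zeta>. deriv (F \<zeta>) 0) sequentially"
    proof (rule uniform_limitI)
      fix e :: real assume "e > 0"
      have "(\<lambda>n. 32 * M / \<tau>\<^sup>2 * h n) \<longlonglongrightarrow> 0"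
        unfolding h_def by real_asymp
      then have "eventually (\<lambda>n. 32 * M / \<tau>\<^sup>2 * h n < e) sequentially"
        using \<open>e > 0\<close> by (rule order_tendstoD)
      then show "eventually (\<lambda>n. \<forall>\<zeta>\<in>ball 0 \<rho>. dist (q n \<zeta>) (deriv (F \<zeta>) 0) < e) sequentially"
      proof eventually_elim
        case (elim n)
        show ?case
          unfolding dist_norm by (intro ballI le_less_trans[OF err elim]) auto
      qed
    qed
    show ?thesis
      unfolding dF
    proof (rule holomorphic_uniform_sequence)
      show "q n holomorphic_on ball 0 \<rho>" for n
      proof -
        have "(\<lambda>\<zeta>. F \<zeta> t) holomorphic_on ball 0 \<rho>" if "cmod t \<le> \<tau>" for t
          unfolding holomorphic_on_open[OF open_ball]
        proof
          fix \<zeta> :: complex assume "\<zeta> \<in> ball 0 \<rho>"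
          then have "norm (t *s axis j 1 + \<zeta> *s u) < 1"
            using in_ball[of \<zeta> t] \<tau> that by (auto simp: add.commute)
          from has_derivative_line_component[OF df[OF this]]
          show "\<exists>D. ((\<lambda>\<zeta>. F \<zeta> t) has_field_derivative D) (at \<zeta>)"
            unfolding F_def by (subst add.commute) blast
        qed
        from this[of "h n"] this[of 0] h[of n] \<tau>
        have "(\<lambda>\<zeta>. F \<zeta> (h n)) holomorphic_on ball 0 \<rho>" "(\<lambda>\<zeta>. F \<zeta> 0) holomorphic_on ball 0 \<rho>"
          by auto
        then show ?thesis
          unfolding q_def using h(1)[of n]
          by (intro holomorphic_on_divide holomorphic_on_diff holomorphic_on_const) auto
      qed
      show "\<exists>d>0. cball x d \<subseteq> ball 0 \<rho> \<and> uniform_limit (cball x d) q (\<lambda>\<zeta>. deriv (F \<zeta>) 0) sequentially"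
        if "x \<in> ball 0 \<rho>" for x
      proof -
        from open_contains_cball_eq[OF open_ball, rule_format, THEN iffD1, OF that]
        obtain d where d: "d > 0" "cball x d \<subseteq> ball 0 \<rho>" by metis
        show ?thesis
          by (intro exI[of _ d] conjI uniform_limit_on_subset[OF lim] d)
      qed
    qed simp
  qed
  have "\<exists>D. ((\<lambda>\<zeta>. cjacobian f (\<zeta> *s u) $ i $ j) has_field_derivative D) (at x)" if "cmod x < 1" for x
  proof -
    have r: "0 < (1 + cmod x) / 2" "(1 + cmod x) / 2 < 1" "cmod x < (1 + cmod x) / 2"
      using that by (auto intro: add_pos_nonneg)
    show ?thesis
      using *[OF r(1,2)] r(3) by (simp add: holomorphic_on_open)
  qed
  then show ?thesis
    by (simp add: holomorphic_on_open)
qed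

section \<open>Extremal points on a sphere\<close>

lemma scaleR_eq_smult: "c *\<^sub>R (z :: complex ^ 'n) = of_real c *s z"
  unfolding vec_eq_iff vector_scaleR_component vector_smult_component
  by (simp add: scaleR_conv_of_real)

lemma matrix_vector_scaleR: "M *v (c *\<^sub>R v) = c *\<^sub>R (M *v (v :: complex ^ 'n))"
  by (simp add: scaleR_eq_smult vector_scalar_commute)

lemma norm_power2_has_real_derivative:
  fixes f :: "complex ^ 'n \<Rightarrow> complex ^ 'm"
  assumes "(\<gamma> has_vector_derivative v) (at t)" "(f has_derivative (*v) M) (at (\<gamma> t))"
  shows "((\<lambda>t. (norm (f (\<gamma> t)))\<^sup>2) has_real_derivative 2 * Re (hinner (M *v v) (f (\<gamma> t)))) (at t)"
proof -
  have "((\<lambda>t. f (\<gamma> t)) has_derivative (\<lambda>h. M *v (h *\<^sub>R v))) (at t)"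
    using diff_chain_at[OF assms[unfolded has_vector_derivative_def]] by (simp add: o_def)
  from has_derivative_inner[OF this this]
  have "((\<lambda>t. f (\<gamma> t) \<bullet> f (\<gamma> t)) has_derivative
      (\<lambda>h. (2 * Re (hinner (M *v v) (f (\<gamma> t)))) * h)) (at t)"
    by (simp add: matrix_vector_scaleR inner_commute inner_eq_Re_hinner[symmetric] algebra_simps)
  then show ?thesis
    by (simp add: has_field_derivative_def power2_norm_eq_inner)
qed

text \<open>The line \<open>z + t *\<^sub>R v\<close> is projected back to the sphere. By Pythagoras
  the normalising factor depends only on the square of \<open>t\<close>, so the projected curve
  still has velocity \<open>v\<close> at 0. The sign \<open>s\<close> turns a minimum into a
  maximum.\<close>

lemma extremal_tangential_derivative:
  fixes f :: "complex ^ 'n \<Rightarrow> complex ^ 'm"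
  assumes df: "(f has_derivative (*v) M) (at z)" and "z \<noteq> 0" "s \<noteq> 0"
    and ext: "\<And>\<xi>. norm \<xi> = norm z \<Longrightarrow> s * (norm (f \<xi>))\<^sup>2 \<le> s * (norm (f z))\<^sup>2"
    and v: "Re (hinner v z) = 0"
  shows "Re (hinner (M *v v) (f z)) = 0"
proof -
  define k where "k = (norm v)\<^sup>2 / (norm z)\<^sup>2"
  have k: "k \<ge> 0" by (simp add: k_def)
  define \<gamma> where "\<gamma> t = (1 / sqrt (1 + t\<^sup>2 * k)) *\<^sub>R (z + t *\<^sub>R v)" for t
  have "((\<lambda>t. 1 / sqrt (1 + t\<^sup>2 * k)) has_real_derivative 0) (at 0)"
    using k by (auto intro!: derivative_eq_intros)
  moreover have "((\<lambda>t. z + t *\<^sub>R v) has_vector_derivative v) (at 0)"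
    by (auto intro!: derivative_eq_intros)
  ultimately have "(\<gamma> has_vector_derivative (1 / sqrt (1 + 0\<^sup>2 * k)) *\<^sub>R v + 0 *\<^sub>R (z + 0 *\<^sub>R v)) (at 0)"
    unfolding \<gamma>_def by (rule has_vector_derivative_scaleR)
  then have d: "(\<gamma> has_vector_derivative v) (at 0)"
    by simp
  have \<gamma>0: "\<gamma> 0 = z" by (simp add: \<gamma>_def)
  have "norm (\<gamma> t) = norm z" for t
  proof -
    have "z \<bullet> v = 0"
      using v by (metis inner_commute inner_eq_Re_hinner)
    then have "(norm (z + t *\<^sub>R v))\<^sup>2 = (norm z)\<^sup>2 + t\<^sup>2 * (norm v)\<^sup>2"
      by (subst norm_add_Pythagorean) (auto simp: orthogonal_def power_mult_distrib)
    also have "\<dots> = (norm z)\<^sup>2 * (1 + t\<^sup>2 * k)"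
      using \<open>z \<noteq> 0\<close> by (simp add: k_def field_simps)
    finally have "norm (z + t *\<^sub>R v) = norm z * sqrt (1 + t\<^sup>2 * k)"
      by (metis norm_ge_zero real_sqrt_abs real_sqrt_mult abs_of_nonneg)
    moreover have "1 + t\<^sup>2 * k > 0"
      using k by (intro add_pos_nonneg) auto
    ultimately show ?thesis
      by (simp add: \<gamma>_def)
  qed
  then have max: "s * (norm (f (\<gamma> t)))\<^sup>2 \<le> s * (norm (f (\<gamma> 0)))\<^sup>2" for t
    using ext by (simp add: \<gamma>0)
  have "((\<lambda>t. s * (norm (f (\<gamma> t)))\<^sup>2) has_real_derivative s * (2 * Re (hinner (M *v v) (f (\<gamma> 0))))) (at 0)"
    by (intro DERIV_cmult norm_power2_has_real_derivative d) (simp add: \<gamma>0 df)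
  from DERIV_local_max[OF this zero_less_one] max \<open>s \<noteq> 0\<close> show ?thesis
    by (simp add: \<gamma>0)
qed

text \<open>Complex tangent vectors are closed under multiplication by \<open>\<i>\<close>, so the
  real first-order condition kills the whole Hermitian product on them. The real tangent vector
  \<open>\<i> *s z\<close> shows that the product for \<open>z\<close> itself is real. Splitting
  \<open>v\<close> along \<open>z\<close> gives the identity.\<close>

lemma extremal_hinner_eq:
  fixes f :: "complex ^ 'n \<Rightarrow> complex ^ 'm"
  assumes df: "(f has_derivative (*v) M) (at z)" and "z \<noteq> 0" "s \<noteq> 0"
    and ext: "\<And>\<xi>. norm \<xi> = norm z \<Longrightarrow> s * (norm (f \<xi>))\<^sup>2 \<le> s * (norm (f z))\<^sup>2"
  shows "hinner (M *v v) (f z) = of_real (Re (hinner (M *v z) (f z)) / (norm z)\<^sup>2) * hinner v z"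
proof -
  note tang = extremal_tangential_derivative[OF assms]
  have rot: "Re (hinner (M *v (\<i> *s w)) (f z)) = - Im (hinner (M *v w) (f z))" for w
    by (simp add: vector_scalar_commute hinner_smult_left)
  have "Im (hinner (M *v z) (f z)) = 0"
    using tang[of "\<i> *s z"] by (simp add: rot hinner_smult_left hinner_self)
  then have z: "hinner (M *v z) (f z) = of_real (Re (hinner (M *v z) (f z)))"
    by (simp add: complex_eq_iff)
  define w where "w = v - (hinner v z / of_real ((norm z)\<^sup>2)) *s z"
  have w: "hinner w z = 0"
    using \<open>z \<noteq> 0\<close> by (simp add: w_def hinner_diff_left hinner_smult_left hinner_self)
  then have "hinner (M *v w) (f z) = 0"
    using tang[of w] tang[of "\<i> *s w"] by (simp add: rot hinner_smult_left complex_eq_iff)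
  then have "hinner (M *v v) (f z) = hinner v z / of_real ((norm z)\<^sup>2) * hinner (M *v z) (f z)"
    by (simp add: w_def matrix_vector_mult_diff_distrib vector_scalar_commute hinner_diff_left hinner_smult_left)
  then show ?thesis
    by (subst (asm) z) (simp add: mult.commute)
qed

lemma norm_power2_eq_sum: "(norm (x :: complex ^ 'n))\<^sup>2 = (\<Sum>i\<in>UNIV. (cmod (x $ i))\<^sup>2)"
  by (simp add: norm_vec_def L2_set_def sum_nonneg)

text \<open>Compare \<open>\<parallel>f\<parallel>\<^sup>2\<close> at \<open>z\<close> with its mean over the four points \<open>(z + \<epsilon> \<i>\<^sup>k \<delta>) / \<surd>(1 + \<epsilon>\<^sup>2)\<close>
  of the same sphere. Averaging over the rotations \<open>\<i>\<^sup>k\<close> kills the second-derivative terms of \<open>f\<close>,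
  so that only \<open>\<epsilon>\<^sup>2 (\<parallel>J \<delta>\<parallel>\<^sup>2 - \<langle>J z, f z\<rangle>)\<close> survives to second order.\<close>

lemma extremal_Levi_inequality:
  fixes f :: "complex ^ 'n \<Rightarrow> complex ^ 'm"
  assumes f: "holomorphic_map_on f (ball 0 1)" and z: "z \<noteq> 0" "norm z < 1"
    and ext: "\<And>\<xi>. norm \<xi> = norm z \<Longrightarrow> s * (norm (f \<xi>))\<^sup>2 \<le> s * (norm (f z))\<^sup>2"
    and \<delta>: "norm \<delta> = norm z" "hinner \<delta> z = 0"
  shows "s * ((norm (cjacobian f z *v \<delta>))\<^sup>2 - Re (hinner (cjacobian f z *v z) (f z))) \<le> 0"
proof -
  define J where "J = cjacobian f"
  define \<mu> where "\<mu> = Re (hinner (J z *v z) (f z))"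
  have df: "(f has_derivative (*v) (J x)) (at x)" if "norm x < 1" for x
    unfolding J_def using that by (intro has_derivative_cjacobian[OF f]) auto
  \<comment> \<open>This radius keeps all the discs used below in one compact ball inside the unit
    ball, where \<open>f\<close> is bounded by a single \<open>M\<close>.\<close>
  define \<rho> where "\<rho> = (1 - norm z) / 2"
  have \<rho>: "\<rho> > 0" "norm z * (1 + \<rho>) < 1" "norm z * (1 + \<rho>) \<ge> 0"
  proof -
    show "\<rho> > 0" using z by (simp add: \<rho>_def)
    have "norm z * \<rho> \<le> \<rho>"
      using z \<open>\<rho> > 0\<close> by (simp add: mult_left_le_one_le)
    moreover have "norm z + \<rho> < 1"
      using z by (simp add: \<rho>_def field_simps)
    ultimately show "norm z * (1 + \<rho>) < 1" by (simp add: distrib_left)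
    show "norm z * (1 + \<rho>) \<ge> 0" using \<open>\<rho> > 0\<close> by simp
  qed
  have "continuous_on (cball 0 (norm z * (1 + \<rho>))) f"
    using \<rho> by (intro continuous_at_imp_continuous_on ballI has_derivative_continuous[OF df]) auto
  then have "compact (f ` cball 0 (norm z * (1 + \<rho>)))"
    by (intro compact_continuous_image) auto
  then obtain M where "\<And>y. y \<in> f ` cball 0 (norm z * (1 + \<rho>)) \<Longrightarrow> norm y \<le> M"
    using compact_imp_bounded bounded_iff by metis
  then have M: "\<And>x. norm x \<le> norm z * (1 + \<rho>) \<Longrightarrow> norm (f x) \<le> M"
    by simp
  define c where "c \<epsilon> = 1 / sqrt (1 + \<epsilon>\<^sup>2)" for \<epsilon> :: real
  have c: "0 < c \<epsilon>" "c \<epsilon> \<le> 1" for \<epsilon>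
    by (simp_all add: c_def add_pos_nonneg)
  have c2: "(c \<epsilon>)\<^sup>2 * (1 + \<epsilon>\<^sup>2) = 1" for \<epsilon>
  proof -
    have "1 + \<epsilon>\<^sup>2 > 0" by (simp add: add_pos_nonneg)
    then show ?thesis by (simp add: c_def power_divide)
  qed
  \<comment> \<open>An affine complex disc, so \<open>f\<close> is holomorphic along it. Its circle
    of radius \<open>\<epsilon>\<close> lies on the sphere through \<open>z\<close>, while its
    centre \<open>c \<epsilon> *\<^sub>R z\<close> lies inside.\<close>
  define G where "G \<epsilon> \<zeta> = c \<epsilon> *\<^sub>R z + \<zeta> *s (c \<epsilon> *\<^sub>R \<delta>)" for \<epsilon> \<zeta>
  have normG: "(norm (G \<epsilon> \<zeta>))\<^sup>2 = (c \<epsilon>)\<^sup>2 * ((norm z)\<^sup>2 * (1 + (cmod \<zeta>)\<^sup>2))" for \<epsilon> \<zeta>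
  proof -
    have "G \<epsilon> \<zeta> = of_real (c \<epsilon>) *s (z + \<zeta> *s \<delta>)"
      by (simp add: G_def scaleR_eq_smult vec_eq_iff algebra_simps)
    moreover have "(norm (z + \<zeta> *s \<delta>))\<^sup>2 = (norm z)\<^sup>2 * (1 + (cmod \<zeta>)\<^sup>2)"
    proof -
      have "z \<bullet> (\<zeta> *s \<delta>) = 0"
        using \<delta>(2) by (subst inner_commute) (simp add: inner_eq_Re_hinner hinner_smult_left)
      then have "(norm (z + \<zeta> *s \<delta>))\<^sup>2 = (norm z)\<^sup>2 + (norm (\<zeta> *s \<delta>))\<^sup>2"
        by (subst norm_add_Pythagorean) (auto simp: orthogonal_def)
      then show ?thesis
        by (simp add: norm_smult \<delta>(1) power_mult_distrib algebra_simps)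
    qed
    ultimately show ?thesis
      using c[of \<epsilon>] by (simp only: norm_smult power_mult_distrib norm_of_real power2_abs)
  qed
  have G_le: "norm (G \<epsilon> \<zeta>) \<le> norm z * (1 + \<rho>)" if "cmod \<zeta> < \<rho>" for \<epsilon> \<zeta>
  proof -
    have "norm (G \<epsilon> \<zeta>) \<le> c \<epsilon> * norm z + cmod \<zeta> * (c \<epsilon> * norm z)"
      unfolding G_def using c[of \<epsilon>] by (intro norm_triangle_le) (simp add: norm_smult \<delta>)
    also have "\<dots> \<le> 1 * norm z + \<rho> * (1 * norm z)"
      using c[of \<epsilon>] that \<rho>(1) by (intro add_mono mult_mono) auto
    finally show ?thesis by (simp add: algebra_simps)
  qed
  define K where "K = 1000 * M\<^sup>2 / \<rho> ^ 3 * real CARD('m)"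
  \<comment> \<open>The variable stands for the square of \<open>\<epsilon>\<close>: the effect of
    the moving centre is then a first-order difference quotient of \<open>\<psi>\<close> at 0,
    although it is second order in \<open>\<epsilon>\<close>.\<close>
  define \<psi> where "\<psi> x = (norm (f ((1 / sqrt (1 + x)) *\<^sub>R z)))\<^sup>2" for x
  define D where "D \<epsilon> = (norm (J (c \<epsilon> *\<^sub>R z) *v (c \<epsilon> *\<^sub>R \<delta>)))\<^sup>2" for \<epsilon>
  have bound: "s * ((\<psi> (0 + \<epsilon>\<^sup>2) - \<psi> 0) / \<epsilon>\<^sup>2 + D \<epsilon>) \<le> \<bar>s\<bar> * (K * \<epsilon>)" if \<epsilon>: "0 < \<epsilon>" "\<epsilon> < \<rho> / 4" for \<epsilon>
  proof -
    define S where "S = (\<Sum>k<4. (norm (f (G \<epsilon> (\<epsilon> * \<i> ^ k))))\<^sup>2) / 4"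
    have dF: "((\<lambda>\<zeta>. f (G \<epsilon> \<zeta>) $ i) has_field_derivative (J (G \<epsilon> \<zeta>) *v (c \<epsilon> *\<^sub>R \<delta>)) $ i) (at \<zeta>)"
      if "cmod \<zeta> < \<rho>" for i \<zeta>
      unfolding G_def
      by (intro has_derivative_line_component df) (use G_le[OF that, of \<epsilon>] \<rho> in \<open>simp add: G_def\<close>)
    have G0: "G \<epsilon> 0 = c \<epsilon> *\<^sub>R z" by (simp add: G_def)
    have "\<bar>(\<Sum>k<4. (cmod (f (G \<epsilon> (\<epsilon> * \<i> ^ k)) $ i))\<^sup>2) / 4 - (cmod (f (c \<epsilon> *\<^sub>R z) $ i))\<^sup>2
        - \<epsilon>\<^sup>2 * (cmod ((J (c \<epsilon> *\<^sub>R z) *v (c \<epsilon> *\<^sub>R \<delta>)) $ i))\<^sup>2\<bar> \<le> 1000 * M\<^sup>2 / \<rho> ^ 3 * \<epsilon> ^ 3" for i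
    proof -
      have "(\<lambda>\<zeta>. f (G \<epsilon> \<zeta>) $ i) holomorphic_on ball 0 \<rho>"
        unfolding holomorphic_on_open[OF open_ball] by (rule ballI, rule exI, rule dF) simp
      moreover have "cmod (f (G \<epsilon> \<zeta>) $ i) \<le> M" if "cmod \<zeta> < \<rho>" for \<zeta>
        using M[OF G_le[OF that]] Finite_Cartesian_Product.norm_nth_le order.trans by blast
      moreover have "deriv (\<lambda>\<zeta>. f (G \<epsilon> \<zeta>) $ i) 0 = (J (c \<epsilon> *\<^sub>R z) *v (c \<epsilon> *\<^sub>R \<delta>)) $ i"
        using DERIV_imp_deriv[OF dF[of 0]] \<rho> by (simp add: G0)
      ultimately show ?thesis
        using four_point_mean_expansion[of "\<lambda>\<zeta>. f (G \<epsilon> \<zeta>) $ i" \<rho> M \<epsilon>] \<epsilon> \<rho> by (simp add: G0)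
    qed
    then have "\<bar>\<Sum>i\<in>UNIV. (\<Sum>k<4. (cmod (f (G \<epsilon> (\<epsilon> * \<i> ^ k)) $ i))\<^sup>2) / 4 - (cmod (f (c \<epsilon> *\<^sub>R z) $ i))\<^sup>2
        - \<epsilon>\<^sup>2 * (cmod ((J (c \<epsilon> *\<^sub>R z) *v (c \<epsilon> *\<^sub>R \<delta>)) $ i))\<^sup>2\<bar> \<le> (\<Sum>i\<in>(UNIV :: 'm set). 1000 * M\<^sup>2 / \<rho> ^ 3 * \<epsilon> ^ 3)"
      by (intro order.trans[OF sum_abs sum_mono])
    moreover have "(\<Sum>i\<in>UNIV. (\<Sum>k<4. (cmod (f (G \<epsilon> (\<epsilon> * \<i> ^ k)) $ i))\<^sup>2) / 4 - (cmod (f (c \<epsilon> *\<^sub>R z) $ i))\<^sup>2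
        - \<epsilon>\<^sup>2 * (cmod ((J (c \<epsilon> *\<^sub>R z) *v (c \<epsilon> *\<^sub>R \<delta>)) $ i))\<^sup>2) = S - \<psi> (\<epsilon>\<^sup>2) - \<epsilon>\<^sup>2 * D \<epsilon>"
      unfolding S_def \<psi>_def D_def norm_power2_eq_sum c_def[symmetric] sum_subtractf
      by (subst sum.swap) (simp add: sum_divide_distrib sum_distrib_left)
    ultimately have 1: "\<bar>S - \<psi> (\<epsilon>\<^sup>2) - \<epsilon>\<^sup>2 * D \<epsilon>\<bar> \<le> K * \<epsilon> ^ 3"
      by (simp add: K_def mult_ac)
    have "s * (norm (f (G \<epsilon> (\<epsilon> * \<i> ^ k))))\<^sup>2 \<le> s * \<psi> 0" for k
    proof -
      have "(norm (G \<epsilon> (\<epsilon> * \<i> ^ k)))\<^sup>2 = (norm z)\<^sup>2 * ((c \<epsilon>)\<^sup>2 * (1 + \<epsilon>\<^sup>2))"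
        using \<epsilon> by (simp add: normG norm_mult norm_power)
      then have "norm (G \<epsilon> (\<epsilon> * \<i> ^ k)) = norm z"
        by (simp add: c2)
      then show ?thesis using ext by (simp add: \<psi>_def)
    qed
    then have "(\<Sum>k<(4::nat). s * (norm (f (G \<epsilon> (\<epsilon> * \<i> ^ k))))\<^sup>2) \<le> (\<Sum>k<(4::nat). s * \<psi> 0)"
      by (intro sum_mono)
    then have "s * S \<le> s * \<psi> 0"
      by (simp add: S_def flip: sum_distrib_left)
    moreover have "s * (\<psi> (\<epsilon>\<^sup>2) + \<epsilon>\<^sup>2 * D \<epsilon> - S) \<le> \<bar>s\<bar> * (K * \<epsilon> ^ 3)"
    proof -
      have "s * (\<psi> (\<epsilon>\<^sup>2) + \<epsilon>\<^sup>2 * D \<epsilon> - S) \<le> \<bar>s\<bar> * \<bar>S - \<psi> (\<epsilon>\<^sup>2) - \<epsilon>\<^sup>2 * D \<epsilon>\<bar>"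
        using abs_ge_self[of "s * (\<psi> (\<epsilon>\<^sup>2) + \<epsilon>\<^sup>2 * D \<epsilon> - S)"]
          abs_minus_commute[of S "\<psi> (\<epsilon>\<^sup>2) + \<epsilon>\<^sup>2 * D \<epsilon>"]
        by (simp add: abs_mult diff_diff_eq)
      also have "\<dots> \<le> \<bar>s\<bar> * (K * \<epsilon> ^ 3)"
        using 1 by (rule mult_left_mono) simp
      finally show ?thesis .
    qed
    ultimately have "s * (\<psi> (\<epsilon>\<^sup>2) - \<psi> 0 + \<epsilon>\<^sup>2 * D \<epsilon>) \<le> \<bar>s\<bar> * (K * \<epsilon> ^ 3)"
      by (simp add: algebra_simps)
    then have "s * (\<psi> (\<epsilon>\<^sup>2) - \<psi> 0 + \<epsilon>\<^sup>2 * D \<epsilon>) / \<epsilon>\<^sup>2 \<le> \<bar>s\<bar> * (K * \<epsilon> ^ 3) / \<epsilon>\<^sup>2"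
      by (rule divide_right_mono) simp
    moreover have "s * (\<psi> (\<epsilon>\<^sup>2) - \<psi> 0 + \<epsilon>\<^sup>2 * D \<epsilon>) / \<epsilon>\<^sup>2 = s * ((\<psi> (0 + \<epsilon>\<^sup>2) - \<psi> 0) / \<epsilon>\<^sup>2 + D \<epsilon>)"
      using \<epsilon> by (simp add: field_simps)
    moreover have "\<bar>s\<bar> * (K * \<epsilon> ^ 3) / \<epsilon>\<^sup>2 = \<bar>s\<bar> * (K * \<epsilon>)"
      using \<epsilon> by (simp add: power2_eq_square power3_eq_cube)
    ultimately show ?thesis by simp
  qed
  have sq: "filterlim (\<lambda>\<epsilon>::real. \<epsilon>\<^sup>2) (at 0) (at_right 0)"
    by real_asymp
  have "((\<lambda>x. (1 / sqrt (1 + x)) *\<^sub>R z) has_vector_derivative (- 1 / 2) *\<^sub>R z) (at 0)"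
    by (auto intro!: derivative_eq_intros)
  then have "(\<psi> has_real_derivative 2 * Re (hinner (J z *v ((- 1 / 2) *\<^sub>R z)) (f ((1 / sqrt (1 + 0)) *\<^sub>R z)))) (at 0)"
    unfolding \<psi>_def[abs_def] by (rule norm_power2_has_real_derivative) (simp add: df z)
  moreover have "2 * Re (hinner (J z *v ((- 1 / 2) *\<^sub>R z)) (f ((1 / sqrt (1 + 0)) *\<^sub>R z))) = - \<mu>"
    unfolding matrix_vector_scaleR unfolding scaleR_eq_smult hinner_smult_left by (simp add: \<mu>_def)
  ultimately have "(\<psi> has_real_derivative - \<mu>) (at 0)"
    by simp
  then have lim1: "((\<lambda>\<epsilon>. (\<psi> (0 + \<epsilon>\<^sup>2) - \<psi> 0) / \<epsilon>\<^sup>2) \<longlongrightarrow> - \<mu>) (at_right 0)"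
    unfolding DERIV_def using sq by (rule filterlim_compose)
  have limc: "(c \<longlongrightarrow> 1) (at_right 0)"
    unfolding c_def by real_asymp
  define u where "u = (1 / norm z) *\<^sub>R z"
  have u: "norm u = 1" using z by (simp add: u_def)
  \<comment> \<open>\<open>D\<close> evaluates the Jacobian at the moving centre, so its limit needs
    continuity of the entries along the ray through \<open>z\<close>.\<close>
  have limJ: "((\<lambda>\<epsilon>. J (c \<epsilon> *\<^sub>R z) $ i $ j) \<longlongrightarrow> J z $ i $ j) (at_right 0)" for i j
  proof -
    have "isCont (\<lambda>\<zeta>. J (\<zeta> *s u) $ i $ j) (of_real (norm z))"
      using holomorphic_on_imp_continuous_on[OF holomorphic_cjacobian_line[OF f u]] z
      by (auto simp: J_def continuous_on_eq_continuous_at)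
    moreover have "((\<lambda>\<epsilon>. of_real (c \<epsilon> * norm z) :: complex) \<longlongrightarrow> of_real (1 * norm z)) (at_right 0)"
      by (intro tendsto_intros limc)
    then have "((\<lambda>\<epsilon>. of_real (c \<epsilon> * norm z) :: complex) \<longlongrightarrow> of_real (norm z)) (at_right 0)"
      by simp
    ultimately have "((\<lambda>\<epsilon>. J (of_real (c \<epsilon> * norm z) *s u) $ i $ j) \<longlongrightarrow> J (of_real (norm z) *s u) $ i $ j) (at_right 0)"
      by (rule isCont_tendsto_compose)
    moreover have "of_real (t * norm z) *s u = t *\<^sub>R z" for t
      unfolding scaleR_eq_smult[symmetric] u_def using z by simp
    from this this[of 1] have "of_real (c \<epsilon> * norm z) *s u = c \<epsilon> *\<^sub>R z" "of_real (norm z) *s u = z" for \<epsilon>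
      by simp_all
    ultimately show ?thesis
      by (simp only:)
  qed
  have "((\<lambda>\<epsilon>. J (c \<epsilon> *\<^sub>R z) *v (c \<epsilon> *\<^sub>R \<delta>)) \<longlongrightarrow> J z *v (1 *\<^sub>R \<delta>)) (at_right 0)"
    by (rule vec_tendstoI) (unfold matrix_vector_mult_def vec_lambda_beta vector_scaleR_component,
        intro tendsto_intros limJ limc)
  then have lim2: "(D \<longlongrightarrow> (norm (J z *v \<delta>))\<^sup>2) (at_right 0)"
    unfolding D_def by (intro tendsto_intros) simp
  have "s * (- \<mu> + (norm (J z *v \<delta>))\<^sup>2) \<le> \<bar>s\<bar> * (K * 0)"
  proof (rule tendsto_le)
    show "((\<lambda>\<epsilon>. s * ((\<psi> (0 + \<epsilon>\<^sup>2) - \<psi> 0) / \<epsilon>\<^sup>2 + D \<epsilon>)) \<longlongrightarrow> s * (- \<mu> + (norm (J z *v \<delta>))\<^sup>2)) (at_right 0)"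
      by (intro tendsto_intros lim1 lim2)
    show "((\<lambda>\<epsilon>. \<bar>s\<bar> * (K * \<epsilon>)) \<longlongrightarrow> \<bar>s\<bar> * (K * 0)) (at_right 0)"
      by (intro tendsto_intros)
    show "\<forall>\<^sub>F \<epsilon> in at_right 0. s * ((\<psi> (0 + \<epsilon>\<^sup>2) - \<psi> 0) / \<epsilon>\<^sup>2 + D \<epsilon>) \<le> \<bar>s\<bar> * (K * \<epsilon>)"
      using bound \<rho> by (subst eventually_at_right[of 0 "\<rho> / 4"]) (auto intro!: exI[of _ "\<rho> / 4"])
  qed simp
  then show ?thesis
    by (simp add: J_def \<mu>_def algebra_simps)
qed

section \<open>Janowski starlike maps\<close>

lemma matrix_inv_mult_vec:
  fixes M :: "complex ^ 'n ^ 'n"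
  assumes "invertible M"
  shows "M *v (matrix_inv M *v b) = b" "matrix_inv M *v (M *v b) = b"
proof -
  have "M ** matrix_inv M = mat 1 \<and> matrix_inv M ** M = mat 1"
    using assms unfolding invertible_def matrix_inv_def by (rule someI_ex)
  then show "M *v (matrix_inv M *v b) = b" "matrix_inv M *v (M *v b) = b"
    by (simp_all add: matrix_vector_mul_assoc)
qed

text \<open>By Cramer's rule the component is a quotient of determinants, hence of polynomials in
  holomorphic functions.\<close>

lemma holomorphic_matrix_inv_mult:
  fixes J :: "complex \<Rightarrow> complex ^ 'n ^ 'n" and b :: "complex \<Rightarrow> complex ^ 'n"
  assumes J: "\<And>i j. (\<lambda>\<zeta>. J \<zeta> $ i $ j) holomorphic_on S"
    and b: "\<And>i. (\<lambda>\<zeta>. b \<zeta> $ i) holomorphic_on S"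
    and inv: "\<And>\<zeta>. \<zeta> \<in> S \<Longrightarrow> invertible (J \<zeta>)"
  shows "(\<lambda>\<zeta>. (matrix_inv (J \<zeta>) *v b \<zeta>) $ k) holomorphic_on S"
proof -
  have nz: "det (J \<zeta>) \<noteq> 0" if "\<zeta> \<in> S" for \<zeta>
    using inv[OF that] by (simp add: invertible_det_nz)
  have entry: "(\<lambda>\<zeta>. (if j = k then b \<zeta> $ i else J \<zeta> $ i $ j)) holomorphic_on S" for i j
    by (cases "j = k") (simp_all add: J b)
  have "(\<lambda>\<zeta>. det (\<chi> i j. if j = k then b \<zeta> $ i else J \<zeta> $ i $ j) / det (J \<zeta>)) holomorphic_on S"
    unfolding det_def vec_lambda_beta
    by (intro holomorphic_on_divide holomorphic_on_sum holomorphic_on_mult holomorphic_on_prod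
        holomorphic_on_const entry J) (use nz in \<open>simp add: det_def\<close>)
  moreover have "(matrix_inv (J \<zeta>) *v b \<zeta>) $ k
      = det (\<chi> i j. if j = k then b \<zeta> $ i else J \<zeta> $ i $ j) / det (J \<zeta>)" if "\<zeta> \<in> S" for \<zeta>
    using cramer[OF nz[OF that], THEN iffD1, OF matrix_inv_mult_vec(1)[OF inv[OF that], of "b \<zeta>"]]
    by (simp add: vec_eq_iff)
  ultimately show ?thesis
    using holomorphic_transform by (metis (no_types, lifting))
qed

lemma Janowski_denominator:
  assumes "-1 \<le> (a :: real)" "a \<le> 1" "cmod w < 1"
  shows "1 + of_real a * w \<noteq> 0"
proof
  assume "1 + of_real a * w = 0"
  then have "of_real a * w = -1"
    by (simp add: add_eq_0_iff)
  then have "\<bar>a\<bar> * cmod w = 1"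
    by (metis norm_minus_cancel norm_mult norm_of_real norm_one)
  moreover have "\<bar>a\<bar> * cmod w \<le> 1 * cmod w"
    using assms by (intro mult_right_mono) auto
  ultimately show False using assms by simp
qed

text \<open>On the slice through \<open>z\<close> the starlikeness quotient extends holomorphically
  to the centre with value 1. It is subordinate to the Moebius map \<open>g\<close>; inverting
  \<open>g\<close> gives a self-map of the disc fixing 0, to which the Schwarz lemma
  applies.\<close>

lemma g_starlike_Schwarz:
  fixes f :: "complex ^ 'n \<Rightarrow> complex ^ 'n"
  assumes AB: "-1 \<le> A" "A < B" "B \<le> 1"
    and g: "\<And>\<zeta>. \<zeta> \<in> ball 0 1 \<Longrightarrow> g \<zeta> = (1 + of_real A * \<zeta>) / (1 + of_real B * \<zeta>)"
    and f: "f \<in> g_starlike g" and z: "z \<noteq> 0" "norm z < 1"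
  obtains w where "cmod w \<le> norm z"
    "hinner (matrix_inv (cjacobian f z) *v f z) z / of_real ((norm z)\<^sup>2)
       = (1 + of_real A * w) / (1 + of_real B * w)"
proof -
  have hol: "holomorphic_map_on f (ball 0 1)" and f0: "f 0 = 0" and J0: "cjacobian f 0 = mat 1"
    and inv: "\<And>x. norm x < 1 \<Longrightarrow> invertible (cjacobian f x)"
    and range: "\<And>x. norm x < 1 \<Longrightarrow> x \<noteq> 0 \<Longrightarrow>
       hinner (matrix_inv (cjacobian f x) *v f x) x / of_real ((norm x)\<^sup>2) \<in> g ` ball 0 1"
    using f by (auto simp: g_starlike_def)
  define u where "u = of_real (1 / norm z) *s z"
  have u: "norm u = 1" using z by (simp add: u_def norm_smult norm_divide)
  have zu: "of_real (norm z) *s u = z" using z by (simp add: u_def)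
  have in_ball: "norm (\<zeta> *s u) < 1" if "cmod \<zeta> < 1" for \<zeta>
    using that by (simp add: norm_smult u)
  define J where "J \<zeta> = cjacobian f (\<zeta> *s u)" for \<zeta>
  have J: "(\<lambda>\<zeta>. J \<zeta> $ i $ j) holomorphic_on ball 0 1" for i j
    unfolding J_def by (rule holomorphic_cjacobian_line[OF hol u])
  have df: "((\<lambda>\<zeta>. f (\<zeta> *s u) $ i) has_field_derivative (J \<zeta> *v u) $ i) (at \<zeta>)" if "cmod \<zeta> < 1" for i \<zeta>
    using has_derivative_line_component[of f "J \<zeta>" 0 \<zeta> u i]
      has_derivative_cjacobian[OF hol open_ball, of "\<zeta> *s u"] in_ball[OF that] by (simp add: J_def)
  have fu: "(\<lambda>\<zeta>. f (\<zeta> *s u) $ i) holomorphic_on ball 0 1" for i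
    unfolding holomorphic_on_open[OF open_ball] by (rule ballI, rule exI, rule df) simp
  define Y where "Y k \<zeta> = (matrix_inv (J \<zeta>) *v f (\<zeta> *s u)) $ k" for k \<zeta>
  have Y: "Y k holomorphic_on ball 0 1" for k
    unfolding Y_def[abs_def]
    by (intro holomorphic_matrix_inv_mult J fu) (simp add: J_def inv in_ball)
  have Y0: "Y k 0 = 0" for k
    by (simp add: Y_def f0)
  have dY: "(Y k has_field_derivative u $ k) (at 0)" for k
  proof -
    have D: "(h has_field_derivative deriv h 0) (at 0)" if "h holomorphic_on ball 0 1" for h :: "complex \<Rightarrow> complex"
      by (rule holomorphic_derivI[OF that]) auto
    \<comment> \<open>Differentiating the product of \<open>J\<close> and \<open>Y\<close>, which is
      \<open>f\<close> on the slice, avoids differentiating the inverse. At 0 only the derivative of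
      \<open>Y k\<close> survives, since \<open>Y\<close> vanishes there and \<open>J\<close> is the
      identity.\<close>
    have "((\<lambda>\<zeta>. \<Sum>j\<in>UNIV. J \<zeta> $ k $ j * Y j \<zeta>) has_field_derivative
        (\<Sum>j\<in>UNIV. deriv (\<lambda>\<zeta>. J \<zeta> $ k $ j) 0 * Y j 0 + deriv (Y j) 0 * J 0 $ k $ j)) (at 0)"
      by (intro DERIV_sum DERIV_mult D J Y)
    also have "(\<Sum>j\<in>UNIV. deriv (\<lambda>\<zeta>. J \<zeta> $ k $ j) 0 * Y j 0 + deriv (Y j) 0 * J 0 $ k $ j) = deriv (Y k) 0"
      by (simp add: Y0 J_def J0 mat_def if_distrib cong: if_cong)
    finally have "((\<lambda>\<zeta>. f (\<zeta> *s u) $ k) has_field_derivative deriv (Y k) 0) (at 0)"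
    proof (rule has_field_derivative_transform_within_open[OF _ open_ball[of 0 1]])
      fix \<zeta> :: complex assume "\<zeta> \<in> ball 0 1"
      then have "J \<zeta> *v (matrix_inv (J \<zeta>) *v f (\<zeta> *s u)) = f (\<zeta> *s u)"
        by (intro matrix_inv_mult_vec) (simp add: J_def inv in_ball)
      then show "(\<Sum>j\<in>UNIV. J \<zeta> $ k $ j * Y j \<zeta>) = f (\<zeta> *s u) $ k"
        unfolding Y_def by (metis (no_types, lifting) matrix_vector_mult_def vec_lambda_beta sum.cong)
    qed simp
    moreover have "((\<lambda>\<zeta>. f (\<zeta> *s u) $ k) has_field_derivative u $ k) (at 0)"
      using df[of 0 k] by (simp add: J_def J0)
    ultimately have "deriv (Y k) 0 = u $ k"
      by (rule DERIV_unique)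
    then show ?thesis
      using D[OF Y[of k]] by simp
  qed
  define \<psi> where "\<psi> \<zeta> = (\<Sum>k\<in>UNIV. Y k \<zeta> * cnj (u $ k))" for \<zeta>
  have \<psi>: "\<psi> holomorphic_on ball 0 1"
    unfolding \<psi>_def[abs_def]
    by (intro holomorphic_on_sum holomorphic_on_mult holomorphic_on_const Y)
  have \<psi>0: "\<psi> 0 = 0" by (simp add: \<psi>_def Y0)
  have "(\<psi> has_field_derivative (\<Sum>k\<in>UNIV. u $ k * cnj (u $ k))) (at 0)"
    unfolding \<psi>_def[abs_def] by (intro DERIV_sum DERIV_cmult_right dY)
  moreover have "(\<Sum>k\<in>UNIV. u $ k * cnj (u $ k)) = 1"
    using hinner_self[of u] by (simp add: hinner_def u)
  ultimately have d\<psi>: "deriv \<psi> 0 = 1"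
    by (simp add: DERIV_imp_deriv)
  \<comment> \<open>The conjugate of \<open>\<zeta>\<close> cancels from the starlikeness quotient,
    leaving \<open>\<psi> \<zeta> / \<zeta>\<close> with a removable singularity.\<close>
  define \<phi> where "\<phi> \<zeta> = (if \<zeta> = 0 then deriv \<psi> 0 else (\<psi> \<zeta> - \<psi> 0) / (\<zeta> - 0))" for \<zeta>
  have \<phi>: "\<phi> holomorphic_on ball 0 1"
    unfolding \<phi>_def[abs_def] by (rule pole_lemma_open[OF \<psi>]) simp
  have \<phi>_eq: "\<phi> \<zeta> = hinner (matrix_inv (J \<zeta>) *v f (\<zeta> *s u)) (\<zeta> *s u) / of_real ((norm (\<zeta> *s u))\<^sup>2)"
    if "\<zeta> \<noteq> 0" for \<zeta>
  proof -
    have "\<psi> \<zeta> = hinner (matrix_inv (J \<zeta>) *v f (\<zeta> *s u)) u"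
      by (simp add: \<psi>_def Y_def hinner_def)
    moreover have "of_real ((norm (\<zeta> *s u))\<^sup>2) = \<zeta> * cnj \<zeta>"
      by (simp add: norm_smult u flip: complex_norm_square)
    ultimately show ?thesis
      unfolding hinner_smult_right using that by (simp add: \<phi>_def \<psi>0)
  qed
  have ex: "\<exists>w. cmod w < 1 \<and> \<phi> \<zeta> = (1 + of_real A * w) / (1 + of_real B * w)" if "cmod \<zeta> < 1" for \<zeta>
  proof (cases "\<zeta> = 0")
    case True
    then show ?thesis
      by (intro exI[of _ 0]) (simp add: \<phi>_def d\<psi>)
  next
    case False
    have "\<zeta> *s u \<noteq> 0"
      using False u by auto
    from range[OF in_ball[OF that] this] show ?thesis
      unfolding \<phi>_eq[OF False] J_def using g by auto
  qed
  \<comment> \<open>The inverse Moebius map applied to \<open>\<phi>\<close>. Its denominator equals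
    \<open>B - A\<close> over \<open>1 + B * w\<close>, nonzero because
    \<open>A < B\<close>.\<close>
  define \<omega> where "\<omega> \<zeta> = (1 - \<phi> \<zeta>) / (of_real B * \<phi> \<zeta> - of_real A)" for \<zeta>
  have \<omega>: "cmod (\<omega> \<zeta>) < 1 \<and> \<phi> \<zeta> = (1 + of_real A * \<omega> \<zeta>) / (1 + of_real B * \<omega> \<zeta>)
      \<and> of_real B * \<phi> \<zeta> - of_real A \<noteq> 0" if \<zeta>: "cmod \<zeta> < 1" for \<zeta>
  proof -
    obtain w where w: "cmod w < 1" "\<phi> \<zeta> = (1 + of_real A * w) / (1 + of_real B * w)"
      using ex[OF \<zeta>] by blast
    have nz: "1 + of_real B * w \<noteq> 0"
      using AB w by (intro Janowski_denominator) auto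
    have BA: "of_real B - of_real A \<noteq> (0 :: complex)"
      using AB by (simp flip: of_real_diff)
    have 1: "of_real B * \<phi> \<zeta> - of_real A = (of_real B - of_real A) / (1 + of_real B * w)"
      using nz by (simp add: w(2) field_simps)
    have "1 - \<phi> \<zeta> = (of_real B - of_real A) * w / (1 + of_real B * w)"
      using nz by (simp add: w(2) field_simps)
    then have "\<omega> \<zeta> = w"
      unfolding \<omega>_def 1 using nz BA by (simp add: field_simps)
    then show ?thesis
      using w nz BA 1 by simp
  qed
  have "of_real B * \<phi> \<zeta> - of_real A \<noteq> 0" if "\<zeta> \<in> ball 0 1" for \<zeta>
    using conjunct2[OF conjunct2[OF \<omega>[of \<zeta>]]] that by simp
  then have "\<omega> holomorphic_on ball 0 1"
    unfolding \<omega>_def[abs_def]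
    by (intro holomorphic_on_divide holomorphic_on_diff holomorphic_on_mult holomorphic_on_const \<phi>)
  moreover have "\<omega> 0 = 0" by (simp add: \<omega>_def \<phi>_def d\<psi>)
  ultimately have "cmod (\<omega> (of_real (norm z))) \<le> cmod (of_real (norm z))"
    using \<omega> z by (intro Schwarz_Lemma) auto
  moreover have "hinner (matrix_inv (cjacobian f z) *v f z) z / of_real ((norm z)\<^sup>2) = \<phi> (of_real (norm z))"
    using \<phi>_eq[of "of_real (norm z)"] z by (simp add: J_def zu)
  ultimately show ?thesis
    using that[of "\<omega> (of_real (norm z))"] \<omega>[of "of_real (norm z)"] z by simp
qed

text \<open>A zero of \<open>f\<close> would make the starlikeness quotient vanish, but
  \<open>1 + A * w\<close> has no zero in the open disc. This legitimises the logarithms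
  below.\<close>

lemma g_starlike_nonzero:
  fixes f :: "complex ^ 'n \<Rightarrow> complex ^ 'n"
  assumes AB: "-1 \<le> A" "A < B" "B \<le> 1"
    and g: "\<And>\<zeta>. \<zeta> \<in> ball 0 1 \<Longrightarrow> g \<zeta> = (1 + of_real A * \<zeta>) / (1 + of_real B * \<zeta>)"
    and f: "f \<in> g_starlike g" and z: "z \<noteq> 0" "norm z < 1"
  shows "f z \<noteq> 0"
proof
  assume fz: "f z = 0"
  obtain w where w: "cmod w \<le> norm z"
    "hinner (matrix_inv (cjacobian f z) *v f z) z / of_real ((norm z)\<^sup>2) = (1 + of_real A * w) / (1 + of_real B * w)"
    using g_starlike_Schwarz[OF AB g f z] by metis
  have "1 + of_real A * w \<noteq> 0" "1 + of_real B * w \<noteq> 0"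
    using AB w(1) z(2) by (simp_all add: Janowski_denominator)
  then show False using w(2) fz by simp
qed

text \<open>\<open>p\<close> is the starlikeness quotient. The first-order identity applied to
  \<open>matrix_inv J *v f z\<close> makes it real, which forces the Schwarz parameter
  \<open>w\<close> to be real. Monotonicity of the real Moebius map then bounds \<open>1 / p\<close>
  by its endpoint values.\<close>

lemma g_starlike_extremal:
  fixes f :: "complex ^ 'n \<Rightarrow> complex ^ 'n"
  assumes AB: "-1 \<le> A" "A < B" "B \<le> 1"
    and g: "\<And>\<zeta>. \<zeta> \<in> ball 0 1 \<Longrightarrow> g \<zeta> = (1 + of_real A * \<zeta>) / (1 + of_real B * \<zeta>)"
    and f: "f \<in> g_starlike g" and z: "z \<noteq> 0" "norm z < 1"
    and s: "s = 1 \<or> s = (-1 :: real)"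
    and ext: "\<And>\<xi>. norm \<xi> = norm z \<Longrightarrow> s * (norm (f \<xi>))\<^sup>2 \<le> s * (norm (f z))\<^sup>2"
  obtains p where "p > 0" "s * (1 / p) \<le> s * ((1 + s * B * norm z) / (1 + s * A * norm z))"
    "Re (hinner (cjacobian f z *v z) (f z)) = (norm (f z))\<^sup>2 / p" 
proof -
  define J where "J = cjacobian f z"
  define \<mu> where "\<mu> = Re (hinner (J *v z) (f z))"
  have df: "(f has_derivative (*v) J) (at z)"
    unfolding J_def using f z by (intro has_derivative_cjacobian[of f "ball 0 1"]) (auto simp: g_starlike_def)
  have inv: "invertible J"
    using f z by (auto simp: g_starlike_def J_def)
  define v where "v = matrix_inv J *v f z"
  obtain w where w: "cmod w \<le> norm z" "hinner v z / of_real ((norm z)\<^sup>2) = (1 + of_real A * w) / (1 + of_real B * w)"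
    using g_starlike_Schwarz[OF AB g f z] unfolding v_def J_def by metis
  have w1: "cmod w < 1" using w z by simp
  have nz: "1 + of_real A * w \<noteq> 0" "1 + of_real B * w \<noteq> 0"
    using AB w1 by (simp_all add: Janowski_denominator)
  have "s \<noteq> 0" using s by auto
  from extremal_hinner_eq[OF df z(1) this ext, of v]
  have "of_real ((norm (f z))\<^sup>2) = of_real (\<mu> / (norm z)\<^sup>2) * hinner v z"
    by (simp only: v_def matrix_inv_mult_vec(1)[OF inv] hinner_self \<mu>_def)
  also have "\<dots> = of_real \<mu> * (hinner v z / of_real ((norm z)\<^sup>2))"
    by simp
  finally have eq: "of_real ((norm (f z))\<^sup>2) = of_real \<mu> * ((1 + of_real A * w) / (1 + of_real B * w))"
    by (simp only: w(2))
  have fz: "f z \<noteq> 0"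
    by (rule g_starlike_nonzero[OF AB g f z])
  then have \<mu>0: "\<mu> \<noteq> 0"
    using eq by auto
  define p where "p = (norm (f z))\<^sup>2 / \<mu>"
  have p: "of_real p = (1 + of_real A * w) / (1 + of_real B * w)"
    unfolding p_def of_real_divide eq using \<mu>0 by simp
  then have p': "of_real p * (1 + of_real B * w) = 1 + of_real A * w"
    using nz by (simp add: field_simps)
  then have Imp: "(p * B - A) * Im w = 0" and Rep: "p + (p * B - A) * Re w = 1"
    by (auto simp: complex_eq_iff algebra_simps)
  \<comment> \<open>Otherwise \<open>Rep\<close> would give \<open>p = 1\<close> and hence
    \<open>A = B\<close>.\<close>
  have "p * B - A \<noteq> 0"
    using Rep AB by auto
  then have "Im w = 0" using Imp by simp
  define x where "x = Re w"
  have wx: "w = of_real x"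
    using \<open>Im w = 0\<close> by (simp add: x_def complex_eq_iff)
  have x: "\<bar>x\<bar> \<le> norm z" using w(1) by (simp add: wx)
  have pos: "1 + a * y > 0" if "-1 \<le> a" "a \<le> 1" "\<bar>y\<bar> \<le> norm z" for a y :: real
  proof -
    have "\<bar>a * y\<bar> \<le> 1 * norm z"
      unfolding abs_mult using that by (intro mult_mono) auto
    then show ?thesis using z by (simp add: abs_le_iff)
  qed
  have posx: "1 + A * x > 0" "1 + B * x > 0"
    using AB x by (auto intro!: pos)
  have "of_real p = (of_real ((1 + A * x) / (1 + B * x)) :: complex)"
    using p by (simp add: wx)
  then have px: "p = (1 + A * x) / (1 + B * x)"
    by (simp only: of_real_eq_iff)
  then have "p > 0" using posx by simp
  \<comment> \<open>After clearing the positive denominators the claim is the sign of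
    \<open>B - A\<close> times \<open>norm z - x\<close> or \<open>norm z + x\<close>.\<close>
  have "s * (1 / p) \<le> s * ((1 + s * B * norm z) / (1 + s * A * norm z))"
    using s
  proof
    assume [simp]: "s = 1"
    have "1 + A * norm z > 0" using AB by (intro pos) auto
    moreover have "0 \<le> (B - A) * (norm z - x)"
      using AB x by (intro mult_nonneg_nonneg) auto
    ultimately show ?thesis
      using posx by (simp add: px divide_simps) (simp add: algebra_simps)
  next
    assume [simp]: "s = -1"
    have "1 + (-A) * norm z > 0" using AB by (intro pos) auto
    moreover have "0 \<le> (B - A) * (norm z + x)"
      using AB x by (intro mult_nonneg_nonneg) auto
    ultimately show ?thesis
      using posx by (simp add: px divide_simps) (simp add: algebra_simps)
  qed
  moreover have "Re (hinner (cjacobian f z *v z) (f z)) = (norm (f z))\<^sup>2 / p"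
    using fz by (simp add: p_def \<mu>_def J_def)
  ultimately show ?thesis
    using that \<open>p > 0\<close> by blast
qed

lemma norm_quotient_tendsto_1:
  fixes f :: "'a :: real_normed_vector \<Rightarrow> 'a"
  assumes "(f has_derivative (\<lambda>h. h)) (at 0)" "f 0 = 0"
  shows "((\<lambda>x. norm (f x) / norm x) \<longlongrightarrow> 1) (at 0)"
proof -
  have 0: "((\<lambda>x. norm (f x - x) / norm x) \<longlongrightarrow> 0) (at 0)"
    using assms by (simp add: has_derivative_at)
  have "((\<lambda>x. norm (f x) / norm x - 1) \<longlongrightarrow> 0) (at 0)"
  proof (rule Lim_null_comparison[OF _ 0])
    show "\<forall>\<^sub>F x in at 0. norm (norm (f x) / norm x - 1) \<le> norm (f x - x) / norm x"
      unfolding eventually_at_filter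
    proof (intro always_eventually allI impI)
      fix x :: 'a assume "x \<noteq> 0"
      then have "norm (norm (f x) / norm x - 1) = \<bar>norm (f x) - norm x\<bar> / norm x"
        by (simp add: divide_simps)
      also have "\<dots> \<le> norm (f x - x) / norm x"
        by (intro divide_right_mono norm_triangle_ineq3) simp
      finally show "norm (norm (f x) / norm x - 1) \<le> norm (f x - x) / norm x" .
    qed
  qed
  then show ?thesis
    by (simp add: LIM_zero_iff)
qed

section \<open>Growth estimate for both signs\<close>

lemma sign_times_mono:
  assumes "s = 1 \<or> s = (-1 :: real)" "s * a \<le> s * b" "s * c \<le> s * d" "0 \<le> a" "0 \<le> b" "0 \<le> c" "0 \<le> d"
  shows "s * (a * c) \<le> s * (b * d)"
  using assms mult_mono[of a b c d] mult_mono[of b a d c] by auto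

lemma sign_power_mono:
  assumes "s = 1 \<or> s = (-1 :: real)" "s * a \<le> s * b" "0 \<le> a" "0 \<le> b"
  shows "s * a ^ n \<le> s * b ^ n"
  using assms power_mono[of a b n] power_mono[of b a n] by auto

text \<open>The antiderivative, zero at 0, of \<open>s * (B - A) / (1 + s * A * t)\<close>. This
  integrand is the excess over 1 of the bound for \<open>1 / p\<close>, divided by \<open>t\<close>,
  so the exponential bounds \<open>norm (f z) / norm z\<close>. The case \<open>A = 0\<close> is the
  limit of the general formula.\<close>

definition Janowski_log_factor :: "real \<Rightarrow> real \<Rightarrow> real \<Rightarrow> real \<Rightarrow> real" where
  "Janowski_log_factor s A B t = (if A = 0 then s * B * t else (B - A) / A * ln (1 + s * A * t))"

lemma Janowski_pos:
  assumes "s = 1 \<or> s = (-1 :: real)" "-1 \<le> a" "a \<le> 1" "0 \<le> t" "t < 1"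
  shows "1 + s * a * t > 0"
proof -
  have "\<bar>s * a * t\<bar> \<le> 1 * t"
    unfolding abs_mult using assms by (intro mult_mono) auto
  then show ?thesis using assms by (simp add: abs_le_iff)
qed

lemma DERIV_Janowski_log_factor:
  assumes "1 + s * A * t > 0"
  shows "(Janowski_log_factor s A B has_real_derivative s * (B - A) / (1 + s * A * t)) (at t)"
proof (cases "A = 0")
  case True
  then show ?thesis
    unfolding Janowski_log_factor_def[abs_def] by (auto intro!: derivative_eq_intros)
next
  case False
  have "((\<lambda>t. (B - A) / A * ln (1 + s * A * t)) has_real_derivative (B - A) / A * (s * A / (1 + s * A * t))) (at t)"
    using assms by (auto intro!: derivative_eq_intros)
  then show ?thesis
    using False unfolding Janowski_log_factor_def[abs_def] by (simp add: mult_ac)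
qed

text \<open>The maximum of \<open>s (ln (\<parallel>f x\<parallel> / \<parallel>x\<parallel>) - L(\<parallel>x\<parallel>)) - \<epsilon> \<parallel>x\<parallel>\<close> over a closed ball is attained at the
  centre: any other maximum point would be extremal on its own sphere, where the radial derivative is
  at most \<open>-\<epsilon>\<close>.\<close>

lemma g_starlike_growth:
  fixes f :: "complex ^ 'n \<Rightarrow> complex ^ 'n"
  assumes AB: "-1 \<le> A" "A < B" "B \<le> 1"
    and g: "\<And>\<zeta>. \<zeta> \<in> ball 0 1 \<Longrightarrow> g \<zeta> = (1 + of_real A * \<zeta>) / (1 + of_real B * \<zeta>)"
    and f: "f \<in> g_starlike g" and z: "z \<noteq> 0" "norm z < 1"
    and s: "s = 1 \<or> s = (-1 :: real)"
  shows "s * ln (norm (f z) / norm z) \<le> s * Janowski_log_factor s A B (norm z)"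
proof -
  define L where "L = Janowski_log_factor s A B"
  have f0: "f 0 = 0" and J0: "cjacobian f 0 = mat 1"
    using f by (auto simp: g_starlike_def)
  have df: "(f has_derivative (*v) (cjacobian f x)) (at x)" if "norm x < 1" for x
    using f that by (intro has_derivative_cjacobian[of f "ball 0 1"]) (auto simp: g_starlike_def)
  have fnz: "f x \<noteq> 0" if "x \<noteq> 0" "norm x < 1" for x
    by (rule g_starlike_nonzero[OF AB g f that])
  define N where "N x = (if x = 0 then 1 else norm (f x) / norm x)" for x
  have N_pos: "N x > 0" if "norm x < 1" for x
    using fnz that by (simp add: N_def)
  have N_cont: "isCont N x" if x: "norm x < 1" for x
  proof (cases "x = 0")
    case True
    have "((\<lambda>x. norm (f x) / norm x) \<longlongrightarrow> 1) (at 0)"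
      using df[of 0] J0 f0 by (intro norm_quotient_tendsto_1) (simp_all add: J0 matrix_vector_mul_lid[abs_def])
    then have "(N \<longlongrightarrow> 1) (at 0)"
      by (rule Lim_transform_eventually) (simp add: N_def eventually_at_filter)
    then show ?thesis
      using True by (simp add: isCont_def N_def)
  next
    case False
    have "isCont (\<lambda>x. norm (f x) / norm x) x"
      using has_derivative_continuous[OF df[OF x]] False by (intro continuous_intros) auto
    moreover have "\<forall>\<^sub>F y in nhds x. N y = norm (f y) / norm y"
      using t1_space_nhds[OF False] by eventually_elim (simp add: N_def)
    ultimately show ?thesis
      by (simp add: isCont_cong)
  qed
  have L_deriv: "(L has_real_derivative s * (B - A) / (1 + s * A * t)) (at t)" if "0 \<le> t" "t < 1" for t
    unfolding L_def using AB s that by (intro DERIV_Janowski_log_factor Janowski_pos) auto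
  have L_cont: "isCont (\<lambda>x. L (norm x)) x" if "norm x < 1" for x :: "complex ^ 'n"
    unfolding isCont_def
    by (rule isCont_tendsto_compose[OF DERIV_isCont[OF L_deriv]]) (use that in \<open>auto intro: tendsto_intros\<close>)
  have L0: "L 0 = 0" by (simp add: L_def Janowski_log_factor_def)
  have main: "s * (ln (N z) - L (norm z)) - \<epsilon> * norm z \<le> 0" if \<epsilon>: "\<epsilon> > 0" for \<epsilon>
  proof -
    define \<Phi> where "\<Phi> x = s * (ln (N x) - L (norm x)) - \<epsilon> * norm x" for x
    have \<Phi>0: "\<Phi> 0 = 0" by (simp add: \<Phi>_def N_def L0)
    have "continuous_on (cball 0 (norm z)) \<Phi>"
      unfolding \<Phi>_def
    proof (intro continuous_at_imp_continuous_on ballI)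
      fix x :: "complex ^ 'n" assume "x \<in> cball 0 (norm z)"
      then have "norm x < 1" using z by simp
      then show "isCont (\<lambda>x. s * (ln (N x) - L (norm x)) - \<epsilon> * norm x) x"
        using N_pos[of x] by (intro continuous_intros N_cont L_cont isCont_ln') auto
    qed
    then obtain x where x: "x \<in> cball 0 (norm z)" "\<And>y. y \<in> cball 0 (norm z) \<Longrightarrow> \<Phi> y \<le> \<Phi> x"
      using continuous_attains_sup[of "cball 0 (norm z)" \<Phi>] by auto
    have x1: "norm x < 1" using x(1) z by simp
    have "x = 0"
    proof (rule ccontr)
      assume x0: "x \<noteq> 0"
      \<comment> \<open>The other terms of \<open>\<Phi>\<close> depend only on the norm, so on one
        sphere a maximum of \<open>\<Phi>\<close> is an extremum of
        \<open>norm (f y)\<close>.\<close>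
      have ext: "s * (norm (f y))\<^sup>2 \<le> s * (norm (f x))\<^sup>2" if y: "norm y = norm x" for y
      proof -
        have y': "y \<noteq> 0" "norm y < 1" using y x0 x1 by auto
        have "\<Phi> y \<le> \<Phi> x" using x y by simp
        then have "s * ln (norm (f y) / norm y) \<le> s * ln (norm (f x) / norm x)"
          using y' x0 y by (simp add: \<Phi>_def N_def algebra_simps)
        then have "s * norm (f y) \<le> s * norm (f x)"
          using s fnz[OF y'] fnz[OF x0 x1] y' x0 y by (auto simp: ln_div)
        then show ?thesis
          using s by (intro sign_power_mono) auto
      qed
      obtain p where p: "p > 0" "s * (1 / p) \<le> s * ((1 + s * B * norm x) / (1 + s * A * norm x))"
        "Re (hinner (cjacobian f x *v x) (f x)) = (norm (f x))\<^sup>2 / p"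
        using g_starlike_extremal[OF AB g f x0 x1 s ext] by metis
      \<comment> \<open>\<open>\<Phi>\<close> along the ray through \<open>x\<close>; half the
        logarithm of the squared norm gives access to the derivative formula for
        \<open>(norm (f x))\<^sup>2\<close>.\<close>
      define k where "k t = s * (ln ((norm (f (t *\<^sub>R x)))\<^sup>2) / 2 - ln (t * norm x) - L (t * norm x)) - \<epsilon> * (t * norm x)" for t
      have \<Phi>k: "\<Phi> (t *\<^sub>R x) = k t" if "0 < t" "t \<le> 1" for t
      proof -
        have "norm (t *\<^sub>R x) \<le> norm x" using that by (simp add: mult_left_le_one_le)
        then have "norm (t *\<^sub>R x) < 1" using x1 by linarith
        then have "f (t *\<^sub>R x) \<noteq> 0"
          using that x0 by (intro fnz) auto
        then show ?thesis
          using that x0 by (simp add: \<Phi>_def k_def N_def ln_div ln_realpow)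
      qed
      have "((\<lambda>t. t *\<^sub>R x) has_vector_derivative x) (at 1)"
        by (auto intro!: derivative_eq_intros)
      then have "((\<lambda>t. (norm (f (t *\<^sub>R x)))\<^sup>2) has_real_derivative 2 * Re (hinner (cjacobian f x *v x) (f (1 *\<^sub>R x)))) (at 1)"
        by (rule norm_power2_has_real_derivative) (use df[OF x1] in simp)
      then have d1: "((\<lambda>t. (norm (f (t *\<^sub>R x)))\<^sup>2) has_real_derivative 2 * ((norm (f x))\<^sup>2 / p)) (at 1)"
        using p(3) by simp
      have "((\<lambda>t. ln ((norm (f (t *\<^sub>R x)))\<^sup>2)) has_real_derivative 1 / (norm (f (1 *\<^sub>R x)))\<^sup>2 * (2 * ((norm (f x))\<^sup>2 / p))) (at 1)"
        using fnz[OF x0 x1] by (intro DERIV_chain2[OF DERIV_ln_divide d1]) simp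
      then have d2: "((\<lambda>t. ln ((norm (f (t *\<^sub>R x)))\<^sup>2)) has_real_derivative 2 / p) (at 1)"
        using fnz[OF x0 x1] by simp
      have lin: "((\<lambda>t. t * norm x) has_real_derivative norm x) (at 1)"
        by (auto intro!: derivative_eq_intros)
      have "((\<lambda>t. ln (t * norm x)) has_real_derivative 1 / (1 * norm x) * norm x) (at 1)"
        using x0 by (intro DERIV_chain2[OF DERIV_ln_divide lin]) simp
      then have d3: "((\<lambda>t. ln (t * norm x)) has_real_derivative 1) (at 1)"
        using x0 by simp
      have d4: "((\<lambda>t. L (t * norm x)) has_real_derivative s * (B - A) / (1 + s * A * (1 * norm x)) * norm x) (at 1)"
        using x1 by (intro DERIV_chain2[OF L_deriv lin]) auto
      have dk: "(k has_real_derivative s * (2 / p / 2 - 1 - s * (B - A) / (1 + s * A * (1 * norm x)) * norm x) - \<epsilon> * norm x) (at 1)"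
        unfolding k_def[abs_def] by (intro DERIV_diff DERIV_cmult DERIV_cdivide d2 d3 d4 lin)
      have pos: "1 + s * A * norm x > 0"
        using AB s x1 by (intro Janowski_pos) auto
      have "1 + s * (B - A) / (1 + s * A * norm x) * norm x = (1 + s * B * norm x) / (1 + s * A * norm x)"
        using pos by (simp add: field_simps)
      then have "s * (2 / p / 2 - 1 - s * (B - A) / (1 + s * A * (1 * norm x)) * norm x)
          = s * (1 / p) - s * ((1 + s * B * norm x) / (1 + s * A * norm x))"
        by (simp only: right_diff_distrib[symmetric] diff_diff_eq mult_1) simp
      then have "s * (2 / p / 2 - 1 - s * (B - A) / (1 + s * A * (1 * norm x)) * norm x) \<le> 0"
        using p(2) by simp
      moreover have "\<epsilon> * norm x > 0" using \<epsilon> x0 by simp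
      ultimately have "s * (2 / p / 2 - 1 - s * (B - A) / (1 + s * A * (1 * norm x)) * norm x) - \<epsilon> * norm x < 0"
        by simp
      \<comment> \<open>Only inward comparison is used, because \<open>x\<close> may lie on the
        boundary of the closed ball. A strictly negative radial derivative makes
        \<open>\<Phi>\<close> larger just inside, contradicting maximality; strictness comes from
        \<open>\<epsilon>\<close>.\<close>
      from DERIV_neg_dec_left[OF dk this]
      obtain d where d: "d > 0" "\<And>h. h > 0 \<Longrightarrow> h < d \<Longrightarrow> k 1 < k (1 - h)" by auto
      define h where "h = min (d / 2) (1 / 2)"
      have h: "0 < h" "h < d" "h < 1" using d(1) by (auto simp: h_def min_def)
      have "norm ((1 - h) *\<^sub>R x) \<le> norm x"
        using h by (simp add: mult_left_le_one_le)
      then have "\<Phi> ((1 - h) *\<^sub>R x) \<le> \<Phi> x"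
        using x by simp
      then have "k (1 - h) \<le> k 1"
        using \<Phi>k[of "1 - h"] \<Phi>k[of 1] h by simp
      then show False using d(2)[OF h(1,2)] by simp
    qed
    then have "\<Phi> z \<le> 0"
      using x(2)[of z] \<Phi>0 by simp
    then show ?thesis
      by (simp only: \<Phi>_def)
  qed
  have "s * (ln (N z) - L (norm z)) \<le> 0"
  proof (rule field_le_epsilon)
    fix e :: real assume "e > 0"
    then show "s * (ln (N z) - L (norm z)) \<le> 0 + e"
      using main[of "e / norm z"] z by simp
  qed
  then show ?thesis
    using z by (simp add: N_def L_def algebra_simps)
qed

text \<open>With \<open>F = norm (f z) / norm z\<close> and \<open>q = sqrt (1 / p)\<close>, the
  multiplier \<open>l\<close> is the square of \<open>F * q\<close>, and \<open>F * q\<close> is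
  also the tangential bound. Growth compares \<open>F\<close> with \<open>G\<close>, and the Schwarz
  estimate compares \<open>q\<close> with \<open>sqrt Q\<close>.\<close>

lemma g_starlike_extremal_bounds:
  fixes f :: "complex ^ 'n \<Rightarrow> complex ^ 'n"
  assumes AB: "-1 \<le> A" "A < B" "B \<le> 1"
    and g: "\<And>\<zeta>. \<zeta> \<in> ball 0 1 \<Longrightarrow> g \<zeta> = (1 + of_real A * \<zeta>) / (1 + of_real B * \<zeta>)"
    and f: "f \<in> g_starlike g" and z: "z \<noteq> 0" "norm z < 1"
    and s: "s = 1 \<or> s = (-1 :: real)"
    and ext: "\<And>\<xi>. norm \<xi> = norm z \<Longrightarrow> s * norm (f \<xi>) \<le> s * norm (f z)"
  defines "G \<equiv> exp (Janowski_log_factor s A B (norm z))"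
    and "Q \<equiv> (1 + s * B * norm z) / (1 + s * A * norm z)"
  shows "s * cmod (det (cjacobian f z)) \<le> s * (G ^ CARD('n) * sqrt Q ^ (CARD('n) + 1))"
    and "\<And>\<delta>. \<delta> \<in> hol_tangent_space z \<Longrightarrow> s * norm (cjacobian f z *v \<delta>) \<le> s * (G * sqrt Q * norm \<delta>)"
proof -
  define J where "J = cjacobian f z"
  have hol: "holomorphic_map_on f (ball 0 1)"
    using f by (simp add: g_starlike_def)
  have df: "(f has_derivative (*v) J) (at z)"
    unfolding J_def using z by (intro has_derivative_cjacobian[OF hol]) auto
  have inv: "invertible J"
    using f z by (auto simp: g_starlike_def J_def)
  have ext2: "s * (norm (f \<xi>))\<^sup>2 \<le> s * (norm (f z))\<^sup>2" if "norm \<xi> = norm z" for \<xi>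
    using ext[OF that] s by (intro sign_power_mono) auto
  obtain p where p: "p > 0" "s * (1 / p) \<le> s * Q" "Re (hinner (J *v z) (f z)) = (norm (f z))\<^sup>2 / p"
    using g_starlike_extremal[OF AB g f z s ext2] unfolding J_def Q_def by metis
  define l where "l = (norm (f z))\<^sup>2 / p / (norm z)\<^sup>2"
  have "s \<noteq> 0" using s by auto
  from extremal_hinner_eq[OF df z(1) this ext2]
  have hinner_J: "hinner (J *v v) (f z) = of_real l * hinner v z" for v
    by (simp only: l_def p(3))
  have fz: "f z \<noteq> 0"
    by (rule g_starlike_nonzero[OF AB g f z])
  define F where "F = norm (f z) / norm z"
  define q where "q = sqrt (1 / p)"
  have F: "F > 0" and q: "q > 0"
    using fz z p(1) by (simp_all add: F_def q_def)
  have l: "l = (F * q)\<^sup>2"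
    using p(1) by (simp add: l_def F_def q_def power_mult_distrib power_divide)
  then have l_pos: "l > 0" using F q by simp
  have FG: "s * F \<le> s * G"
  proof -
    have "s * ln F \<le> s * Janowski_log_factor s A B (norm z)"
      unfolding F_def by (rule g_starlike_growth[OF AB g f z s])
    then show ?thesis
      using s F exp_le_cancel_iff[of "ln F" "Janowski_log_factor s A B (norm z)"]
        exp_le_cancel_iff[of "Janowski_log_factor s A B (norm z)" "ln F"]
      by (auto simp: G_def)
  qed
  have Q: "s * q \<le> s * sqrt Q"
    using s p(2) by (auto simp: q_def)
  have Q0: "sqrt Q \<ge> 0" "G \<ge> 0"
    using AB s z Janowski_pos[of s A "norm z"] Janowski_pos[of s B "norm z"] by (simp_all add: Q_def G_def)
  have tangent: "s * norm (J *v \<delta>) \<le> s * (F * q * norm \<delta>)" if \<delta>: "hinner \<delta> z = 0" for \<delta>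
  proof (cases "\<delta> = 0")
    case False
    \<comment> \<open>Rescaling to the norm of \<open>z\<close> required by
      \<open>extremal_Levi_inequality\<close>; the factor cancels by homogeneity.\<close>
    define t where "t = norm z / norm \<delta>"
    have t: "t > 0" using False z by (simp add: t_def)
    have "s * ((norm (J *v (t *\<^sub>R \<delta>)))\<^sup>2 - Re (hinner (J *v z) (f z))) \<le> 0"
      unfolding J_def
    proof (rule extremal_Levi_inequality[OF hol z ext2])
      show "norm (t *\<^sub>R \<delta>) = norm z" using False by (simp add: t_def)
      show "hinner (t *\<^sub>R \<delta>) z = 0" using \<delta> by (simp add: scaleR_eq_smult hinner_smult_left)
    qed
    also have "Re (hinner (J *v z) (f z)) = t\<^sup>2 * (F * q * norm \<delta>)\<^sup>2"
      using False z p by (simp add: t_def F_def q_def power_mult_distrib power_divide)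
    also have "(norm (J *v (t *\<^sub>R \<delta>)))\<^sup>2 = t\<^sup>2 * (norm (J *v \<delta>))\<^sup>2"
      by (simp add: matrix_vector_scaleR power_mult_distrib)
    finally have "t\<^sup>2 * (s * ((norm (J *v \<delta>))\<^sup>2 - (F * q * norm \<delta>)\<^sup>2)) \<le> 0"
      by (simp add: algebra_simps)
    then have "s * ((norm (J *v \<delta>))\<^sup>2 - (F * q * norm \<delta>)\<^sup>2) \<le> 0"
      using t by (simp add: mult_le_0_iff)
    then show ?thesis
      using s F q by (auto intro: power2_le_imp_le)
  qed simp
  show "s * norm (cjacobian f z *v \<delta>) \<le> s * (G * sqrt Q * norm \<delta>)" if "\<delta> \<in> hol_tangent_space z" for \<delta>
  proof -
    have "hinner \<delta> z = 0"
      using that by (simp add: hol_tangent_space_def hinner_def mult.commute)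
    then have "s * norm (J *v \<delta>) \<le> s * (F * q * norm \<delta>)"
      by (rule tangent)
    also have "\<dots> \<le> s * (G * sqrt Q * norm \<delta>)"
      using F q Q0 by (intro sign_times_mono[OF s] FG Q) auto
    finally show ?thesis by (simp add: J_def)
  qed
  obtain m where m: "CARD('n) = Suc m"
    using zero_less_card_finite[where 'a='n] by (metis gr0_implies_Suc)
  have "s * cmod (det J) \<le> s * ((F * q) ^ (CARD('n) - 1) * (l * norm z / norm (f z)))"
    using s
  proof
    assume [simp]: "s = 1"
    have "cmod (det J) \<le> (F * q) ^ (CARD('n) - 1) * (\<bar>l\<bar> * norm z / norm (f z))"
      by (rule norm_det_le_of_hinner_eq[OF z(1) fz _ hinner_J]) (use F q tangent in auto)
    then show ?thesis using l_pos by simp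
  next
    \<comment> \<open>A lower bound for the determinant is an upper bound for that of the inverse,
      which takes the orthogonal complement of \<open>f z\<close> to the tangent space at
      \<open>z\<close> with norm at most \<open>1 / (F * q)\<close>.\<close>
    assume [simp]: "s = -1"
    note inv_J = matrix_inv_mult_vec[OF inv]
    have hinner_inv: "hinner (matrix_inv J *v v) z = of_real (1 / l) * hinner v (f z)" for v
      using hinner_J[of "matrix_inv J *v v"] l_pos by (simp add: inv_J)
    have "cmod (det (matrix_inv J)) \<le> (1 / (F * q)) ^ (CARD('n) - 1) * (\<bar>1 / l\<bar> * norm (f z) / norm z)"
    proof (rule norm_det_le_of_hinner_eq[OF fz z(1) _ hinner_inv])
      fix v assume "hinner v (f z) = 0"
      then have "hinner (matrix_inv J *v v) z = 0"
        by (simp add: hinner_inv)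
      from tangent[OF this] show "norm (matrix_inv J *v v) \<le> 1 / (F * q) * norm v"
        using F q by (simp add: inv_J field_simps)
    qed (use F q in auto)
    also have "\<dots> = 1 / ((F * q) ^ (CARD('n) - 1) * (l * norm z / norm (f z)))"
      using l_pos by (simp add: power_divide)
    finally have *: "cmod (det (matrix_inv J)) \<le> 1 / ((F * q) ^ (CARD('n) - 1) * (l * norm z / norm (f z)))" .
    have "matrix_inv J ** J = mat 1"
      by (simp add: matrix_eq inv_J flip: matrix_vector_mul_assoc)
    then have prod: "cmod (det (matrix_inv J)) * cmod (det J) = 1"
      by (metis det_I det_mul norm_mult norm_one)
    have divide_le_bound: "d \<le> b" if "a * b = 1" "d > 0" "a \<le> 1 / d" "b \<ge> 0" for a b d :: real
      using mult_right_mono[OF that(3,4)] that by (simp add: field_simps)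
    have "(F * q) ^ (CARD('n) - 1) * (l * norm z / norm (f z)) > 0"
      using F q l_pos z fz by simp
    from divide_le_bound[OF prod this * norm_ge_zero] show ?thesis by simp
  qed
  \<comment> \<open>The normal direction contributes \<open>F\<close> times the square of
    \<open>q\<close>, one more factor \<open>q\<close> than each tangential direction.\<close>
  also have "(F * q) ^ (CARD('n) - 1) * (l * norm z / norm (f z)) = F ^ CARD('n) * q ^ (CARD('n) + 1)"
  proof -
    have "l * norm z / norm (f z) = F * q\<^sup>2"
      using fz z by (simp add: l F_def field_simps power2_eq_square)
    then show ?thesis
      by (simp add: m power_mult_distrib power2_eq_square mult_ac)
  qed
  also have "s * \<dots> \<le> s * (G ^ CARD('n) * sqrt Q ^ (CARD('n) + 1))"
    using F q Q0 FG Q by (intro sign_times_mono[OF s] sign_power_mono[OF s]) auto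
  finally show "s * cmod (det (cjacobian f z)) \<le> s * (G ^ CARD('n) * sqrt Q ^ (CARD('n) + 1))"
    by (simp add: J_def)
qed

section \<open>Conversion of the signed bounds to closed form\<close>

theorem corollary3p5:
  fixes A B :: real
    and g :: "complex \<Rightarrow> complex"
    and f :: "complex ^ 'n \<Rightarrow> complex ^ 'n"
  assumes "-1 \<le> A" and "A < B" and "B \<le> 1"
    and "\<And>\<zeta>. \<zeta> \<in> ball 0 1 \<Longrightarrow> g \<zeta> = (1 + of_real A * \<zeta>) / (1 + of_real B * \<zeta>)"
    and "f \<in> g_starlike g"
  shows
    "(\<forall>z\<in>ball 0 1 - {0}.
        (\<forall>\<xi>\<in>sphere 0 (norm z). norm (f \<xi>) \<le> norm (f z)) \<longrightarrow>
          norm (det (cjacobian f z)) \<le>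
            (if A \<noteq> 0
             then (1 + A * norm z) powr (real CARD('n) * (B - A) / A)
                  * ((1 + B * norm z) / (1 + A * norm z)) powr ((real CARD('n) + 1) / 2)
             else exp (real CARD('n) * (B - A) * norm z)
                  * ((1 + B * norm z) / (1 + A * norm z)) powr ((real CARD('n) + 1) / 2))
        \<and> (\<forall>\<delta>\<in>hol_tangent_space z.
             norm (cjacobian f z *v \<delta>) \<le>
               (if A \<noteq> 0
                then (1 + A * norm z) powr ((B - A) / A)
                     * ((1 + B * norm z) / (1 + A * norm z)) powr (1 / 2) * norm \<delta>
                else exp ((B - A) * norm z)
                     * ((1 + B * norm z) / (1 + A * norm z)) powr (1 / 2) * norm \<delta>)))
   \<and> (\<forall>z\<in>ball 0 1 - {0}.
        (\<forall>\<xi>\<in>sphere 0 (norm z). norm (f z) \<le> norm (f \<xi>)) \<longrightarrow>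
          norm (det (cjacobian f z)) \<ge>
            (if A \<noteq> 0
             then (1 - A * norm z) powr (real CARD('n) * (A - B) / (- A))
                  * ((1 - A * norm z) / (1 - B * norm z)) powr (- ((real CARD('n) + 1) / 2))
             else exp (real CARD('n) * (A - B) * norm z)
                  * ((1 - A * norm z) / (1 - B * norm z)) powr (- ((real CARD('n) + 1) / 2)))
        \<and> (\<forall>\<delta>\<in>hol_tangent_space z.
             norm (cjacobian f z *v \<delta>) \<ge>
               (if A \<noteq> 0
                then (1 - A * norm z) powr ((A - B) / (- A))
                     * ((1 - A * norm z) / (1 - B * norm z)) powr (- (1 / 2)) * norm \<delta>
                else exp ((A - B) * norm z)
                     * ((1 - A * norm z) / (1 - B * norm z)) powr (- (1 / 2)) * norm \<delta>)))"
proof -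
  have AB1: "-1 \<le> A" "A \<le> 1" "-1 \<le> B" "B \<le> 1" using assms(1-3) by auto
  \<comment> \<open>The power \<open>n\<close> is the dimension for determinants and 1 for tangent
    vectors.\<close>
  have G: "exp (Janowski_log_factor s A B t) ^ n =
      (if A \<noteq> 0 then (1 + s * A * t) powr (real n * (B - A) / A) else exp (real n * (s * B * t)))"
    if "1 + s * A * t > 0" for s t n
    using that by (auto simp: Janowski_log_factor_def powr_def mult_ac simp flip: exp_of_nat_mult)
  have sqrt_power: "sqrt q ^ n = q powr (real n / 2)" if "q > 0" for q n
    using that by (simp add: powr_half_sqrt[symmetric] powr_powr flip: powr_realpow)
  \<comment> \<open>The lower bounds are stated with the reciprocal quotient and a negative
    exponent.\<close>
  have inverse_powr: "(a / b) powr (- e) = (b / a) powr e" if "a > 0" "b > 0" for a b e :: real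
    using that by (simp add: powr_def ln_div algebra_simps)
  have upper: "norm (det (cjacobian f z)) \<le>
            (if A \<noteq> 0
             then (1 + A * norm z) powr (real CARD('n) * (B - A) / A)
                  * ((1 + B * norm z) / (1 + A * norm z)) powr ((real CARD('n) + 1) / 2)
             else exp (real CARD('n) * (B - A) * norm z)
                  * ((1 + B * norm z) / (1 + A * norm z)) powr ((real CARD('n) + 1) / 2))" (is ?det)
    and upper_tangent: "\<And>\<delta>. \<delta> \<in> hol_tangent_space z \<Longrightarrow> norm (cjacobian f z *v \<delta>) \<le>
               (if A \<noteq> 0
                then (1 + A * norm z) powr ((B - A) / A)
                     * ((1 + B * norm z) / (1 + A * norm z)) powr (1 / 2) * norm \<delta>
                else exp ((B - A) * norm z)
                     * ((1 + B * norm z) / (1 + A * norm z)) powr (1 / 2) * norm \<delta>)" (is "PROP ?tangent")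
    if z: "z \<in> ball 0 1 - {0}" and max: "\<forall>\<xi>\<in>sphere 0 (norm z). norm (f \<xi>) \<le> norm (f z)" for z
  proof -
    have z': "z \<noteq> 0" "norm z < 1" using z by auto
    have pos: "1 + A * norm z > 0" "1 + B * norm z > 0"
      using Janowski_pos[of 1 A "norm z"] Janowski_pos[of 1 B "norm z"] AB1 z' by auto
    then have Q: "(1 + B * norm z) / (1 + A * norm z) > 0" by simp
    have ext: "1 * norm (f \<xi>) \<le> 1 * norm (f z)" if "norm \<xi> = norm z" for \<xi>
      using max that by simp
    note bounds = g_starlike_extremal_bounds[OF assms(1-5) z' disjI1[OF refl] ext]
    have "norm (det (cjacobian f z)) \<le> exp (Janowski_log_factor 1 A B (norm z)) ^ CARD('n)
        * ((1 + B * norm z) / (1 + A * norm z)) powr ((real CARD('n) + 1) / 2)"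
      using bounds(1) sqrt_power[OF Q, of "CARD('n) + 1"] by (simp only: mult_1 of_nat_add of_nat_1)
    then show ?det
      using G[of 1 "norm z" "CARD('n)"] pos by (auto simp: mult_ac)
    show "PROP ?tangent"
      using bounds(2) G[of 1 "norm z" 1] sqrt_power[OF Q, of 1] pos by (auto simp: mult_ac)
  qed
  have lower: "norm (det (cjacobian f z)) \<ge>
            (if A \<noteq> 0
             then (1 - A * norm z) powr (real CARD('n) * (A - B) / (- A))
                  * ((1 - A * norm z) / (1 - B * norm z)) powr (- ((real CARD('n) + 1) / 2))
             else exp (real CARD('n) * (A - B) * norm z)
                  * ((1 - A * norm z) / (1 - B * norm z)) powr (- ((real CARD('n) + 1) / 2)))" (is ?det)
    and lower_tangent: "\<And>\<delta>. \<delta> \<in> hol_tangent_space z \<Longrightarrow> norm (cjacobian f z *v \<delta>) \<ge>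
               (if A \<noteq> 0
                then (1 - A * norm z) powr ((A - B) / (- A))
                     * ((1 - A * norm z) / (1 - B * norm z)) powr (- (1 / 2)) * norm \<delta>
                else exp ((A - B) * norm z)
                     * ((1 - A * norm z) / (1 - B * norm z)) powr (- (1 / 2)) * norm \<delta>)" (is "PROP ?tangent")
    if z: "z \<in> ball 0 1 - {0}" and min: "\<forall>\<xi>\<in>sphere 0 (norm z). norm (f z) \<le> norm (f \<xi>)" for z
  proof -
    have z': "z \<noteq> 0" "norm z < 1" using z by auto
    have pos: "1 - A * norm z > 0" "1 - B * norm z > 0"
      using Janowski_pos[of "-1" A "norm z"] Janowski_pos[of "-1" B "norm z"] AB1 z' by auto
    then have Q: "(1 - B * norm z) / (1 - A * norm z) > 0" by simp
    have ext: "-1 * norm (f \<xi>) \<le> -1 * norm (f z)" if "norm \<xi> = norm z" for \<xi>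
      using min that by simp
    have exponent: "a * (A - B) / (- A) = a * (B - A) / A" "(A - B) / (- A) = (B - A) / A" for a
      by (simp_all add: minus_divide_right[symmetric] minus_divide_left algebra_simps)
    note bounds = g_starlike_extremal_bounds[OF assms(1-5) z' disjI2[OF refl] ext]
    have "norm (det (cjacobian f z)) \<ge> exp (Janowski_log_factor (-1) A B (norm z)) ^ CARD('n)
        * ((1 - B * norm z) / (1 - A * norm z)) powr ((real CARD('n) + 1) / 2)"
      using bounds(1) sqrt_power[OF Q, of "CARD('n) + 1"]
      by (simp only: mult_1 mult_minus_left neg_le_iff_le add_uminus_conv_diff of_nat_add of_nat_1)
    then show ?det
      unfolding inverse_powr[OF pos] exponent
      using G[of "-1" "norm z" "CARD('n)"] pos by (auto simp: algebra_simps)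
    show "PROP ?tangent"
      unfolding inverse_powr[OF pos] exponent
      using bounds(2) G[of "-1" "norm z" 1] sqrt_power[OF Q, of 1] pos by (auto simp: algebra_simps)
  qed
  show ?thesis
    using upper upper_tangent lower lower_tangent by simp
qed

end
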